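(* Let $c_1>|c_2|$ and let $a=\frac{1}{\sqrt2}(\sqrt{c_1+c_2}+\sqrt{c_1-c_2})$, $b=\frac{1}{\sqrt2}(\sqrt{c_1+c_2}-\sqrt{c_1-c_2})$. The equilibria $M^1_{a,b},\,M^1_{-a,-b}\in\mathfrak{t}_1\cap\operatorname{Orb}_{c_1;c_2}$ of the $\mathfrak{so}(4)$ rigid body equations are non-degenerate of center-center type; they are therefore nonlinearly stable on the corresponding adjoint orbit $\operatorname{Orb}_{c_1;c_2}$, and they are also nonlinearly stable for the Lie-Poisson dynamics on $\mathfrak{so}(4)$.
   Context: Let $\lambda_1>\lambda_2>\lambda_3>\lambda_4$ be real numbers with $\lambda_i+\lambda_j>0$ for $i\ne j$, and $J=\operatorname{diag}(\lambda_1,\lambda_2,\lambda_3,\lambda_4)$. The Lie-Poisson dynamics of the $\mathfrak{so}(4)$ rigid body is $\dot M=[M,\Omega]$ on $\mathfrak{so}(4)$ (real antisymmetric $4\times4$ matrices), where $\Omega\in\mathfrak{so}(4)$ is determined by $M=J\Omega+\Omega J$. Write $$M=\begin{bmatrix}0&-x_3&x_2&y_1\\ x_3&0&-x_1&y_2\\ -x_2&x_1&0&y_3\\ -y_1&-y_2&-y_3&0\end{bmatrix}.$$ The following are constants of motion: $C_1=\frac12(\sum x_i^2+\sum y_i^2)$, $C_2=\sum x_iy_i$ (Casimirs), $$H=\tfrac12\left(\tfrac{x_1^2}{\lambda_2+\lambda_3}+\tfrac{x_2^2}{\lambda_1+\lambda_3}+\tfrac{x_3^2}{\lambda_1+\lambda_2}+\tfrac{y_1^2}{\lambda_1+\lambda_4}+\tfrac{y_2^2}{\lambda_2+\lambda_4}+\tfrac{y_3^2}{\lambda_3+\lambda_4}\right),$$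 $$I=(\lambda_2^2+\lambda_3^2)x_1^2+(\lambda_1^2+\lambda_3^2)x_2^2+(\lambda_1^2+\lambda_2^2)x_3^2+(\lambda_1^2+\lambda_4^2)y_1^2+(\lambda_2^2+\lambda_4^2)y_2^2+(\lambda_3^2+\lambda_4^2)y_3^2.$$ For $c_1>|c_2|$, $\operatorname{Orb}_{c_1;c_2}=\{M\mid C_1(M)=c_1,\,C_2(M)=c_2\}$ is a four-dimensional regular adjoint orbit of $\operatorname{SO}(4)$, invariant under the dynamics, with orbit symplectic form $\omega$, $\omega(M)([M,X],[M,Y])=\frac12\operatorname{Trace}(M[X,Y])$. For a function $F$ on $\mathfrak{so}(4)$, the Hamiltonian vector field of $F|_{\operatorname{Orb}_{c_1;c_2}}$ is $X_{F|_{\operatorname{Orb}_{c_1;c_2}}}(M)=[M,\nabla F(M)]$, with the gradient taken relative to $\langle X,Y\rangle=-\frac12\operatorname{Trace}(XY)$; for $F=H$ this is the restriction of the rigid body equation. $M^1_{p,q}$ is the matrix with $x_1=p$, $y_1=q$, $x_2=x_3=y_2=y_3=0$, and $\mathfrak{t}_1=\{M^1_{p,q}\mid p,q\in\mathbb{R}\}$. An equilibrium $M\in\operatorname{Orb}_{c_1;c_2}$ at which the differentials of both $H|_{\operatorname{Orb}_{c_1;c_2}}$ and $I|_{\operatorname{Orb}_{c_1;c_2}}$ vanish is called non-degenerate if the (commuting) linearizations $\mathbf{D}X_{H|_{\operatorname{Orb}_{c_1;c_2}}}(M)$ and $\mathbf{D}X_{I|_{\operatorname{Orb}_{c_1;c_2}}}(M)$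 generate a Cartan subalgebra of the Lie algebra of infinitesimally symplectic linear maps of $(T_M\operatorname{Orb}_{c_1;c_2},\omega(M))$. It is of center-center type if this Cartan subalgebra is conjugate to the algebra of matrices $$\begin{bmatrix} 0&0&-A&0 \\ 0&0&0&-B \\ A&0&0&0 \\ 0&B&0&0 \end{bmatrix},\quad A,B\in\mathbb{R}$$ (eigenvalues $\pm iA,\pm iB$). Nonlinear stability means Lyapunov stability. *)

theory Defs
  imports "HOL-Analysis.Analysis"
begin

section \<open>The Lie algebra so(4)\<close>

definition so4 :: "(real^4^4) set" where
  "so4 = {M. transpose M = - M}"

definition lie_bracket :: "real^4^4 \<Rightarrow> real^4^4 \<Rightarrow> real^4^4" where
  "lie_bracket X Y = X ** Y - Y ** X"

definition so4_inner :: "real^4^4 \<Rightarrow> real^4^4 \<Rightarrow> real" where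
  "so4_inner X Y = - trace (X ** Y) / 2"

definition so4_matrix :: "real^3 \<Rightarrow> real^3 \<Rightarrow> real^4^4" where
  "so4_matrix x y = vector [
     vector [0,       - (x$3), x$2,     y$1],
     vector [x$3,     0,       - (x$1), y$2],
     vector [- (x$2), x$1,     0,       y$3],
     vector [- (y$1), - (y$2), - (y$3), 0  ]]"

text \<open>On \<^const>\<open>so4\<close> the following two functions invert \<^const>\<open>so4_matrix\<close>.\<close>

definition x_coords :: "real^4^4 \<Rightarrow> real^3" where
  "x_coords M = vector [M$3$2, M$1$3, M$2$1]"

definition y_coords :: "real^4^4 \<Rightarrow> real^3" where
  "y_coords M = vector [M$1$4, M$2$4, M$3$4]"

definition M1 :: "real \<Rightarrow> real \<Rightarrow> real^4^4" where
  "M1 p q = so4_matrix (vector [p, 0, 0]) (vector [q, 0, 0])"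

definition cartan_t1 :: "(real^4^4) set" where
  "cartan_t1 = {M1 p q | p q. True}"


section \<open>Rigid body equation and constants of motion\<close>

definition diag_matrix :: "real^4 \<Rightarrow> real^4^4" where
  "diag_matrix l = (\<chi> i j. if i = j then l$i else 0)"

definition angular_velocity :: "real^4 \<Rightarrow> real^4^4 \<Rightarrow> real^4^4" where
  "angular_velocity l M =
     (THE W. W \<in> so4 \<and> M = diag_matrix l ** W + W ** diag_matrix l)"

definition rigid_body :: "real^4 \<Rightarrow> real^4^4 \<Rightarrow> real^4^4" where
  "rigid_body l M = lie_bracket M (angular_velocity l M)"

definition casimir1 :: "real^4^4 \<Rightarrow> real" where
  "casimir1 M = ((\<Sum>i\<in>UNIV. (x_coords M $ i)^2) + (\<Sum>i\<in>UNIV. (y_coords M $ i)^2)) / 2"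

definition casimir2 :: "real^4^4 \<Rightarrow> real" where
  "casimir2 M = (\<Sum>i\<in>UNIV. x_coords M $ i * y_coords M $ i)"

definition energy :: "real^4 \<Rightarrow> real^4^4 \<Rightarrow> real" where
  "energy l M = (let x = x_coords M; y = y_coords M in
     1/2 * ((x$1)^2 / (l$2 + l$3) + (x$2)^2 / (l$1 + l$3) + (x$3)^2 / (l$1 + l$2)
          + (y$1)^2 / (l$1 + l$4) + (y$2)^2 / (l$2 + l$4) + (y$3)^2 / (l$3 + l$4)))"

definition integral_I :: "real^4 \<Rightarrow> real^4^4 \<Rightarrow> real" where
  "integral_I l M = (let x = x_coords M; y = y_coords M in
       ((l$2)^2 + (l$3)^2) * (x$1)^2 + ((l$1)^2 + (l$3)^2) * (x$2)^2
     + ((l$1)^2 + (l$2)^2) * (x$3)^2 + ((l$1)^2 + (l$4)^2) * (y$1)^2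
     + ((l$2)^2 + (l$4)^2) * (y$2)^2 + ((l$3)^2 + (l$4)^2) * (y$3)^2)"


section \<open>Adjoint orbits\<close>

definition orb :: "real \<Rightarrow> real \<Rightarrow> (real^4^4) set" where
  "orb c1 c2 = {M \<in> so4. casimir1 M = c1 \<and> casimir2 M = c2}"

definition orb_tangent :: "real^4^4 \<Rightarrow> (real^4^4) set" where
  "orb_tangent M = {lie_bracket M X | X. X \<in> so4}"

text \<open>The value does not depend on the representatives \<open>X\<close>, \<open>Y\<close> of the tangent vectors
  \<open>u\<close>, \<open>v\<close>, by the invariance of the trace form.\<close>

definition orb_form :: "real^4^4 \<Rightarrow> real^4^4 \<Rightarrow> real^4^4 \<Rightarrow> real" where
  "orb_form M u v = (THE r. \<exists>X\<in>so4. \<exists>Y\<in>so4.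
     u = lie_bracket M X \<and> v = lie_bracket M Y \<and> r = trace (M ** lie_bracket X Y) / 2)"

text \<open>The derivative is taken within \<^const>\<open>so4\<close>: only the values of \<open>F\<close> on
  \<^const>\<open>so4\<close> matter.\<close>

definition so4_gradient :: "(real^4^4 \<Rightarrow> real) \<Rightarrow> real^4^4 \<Rightarrow> real^4^4" where
  "so4_gradient F M = (THE G. G \<in> so4 \<and>
     (F has_derivative (\<lambda>X. so4_inner G X)) (at M within so4))"

definition hamiltonian_field :: "(real^4^4 \<Rightarrow> real) \<Rightarrow> real^4^4 \<Rightarrow> real^4^4" where
  "hamiltonian_field F M = lie_bracket M (so4_gradient F M)"

text \<open>The derivative of \<open>f\<close> restricted to the orbit, as a map on the tangent space. A Frechet
  derivative within the orbit is not unique on the ambient matrix space, but its restriction to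
  the tangent space is. For real-valued \<open>f\<close> this is the differential of \<open>f\<close> on the orbit; for a
  vector field on the orbit that vanishes at \<open>M\<close> it is the linearization at \<open>M\<close>.\<close>

definition orb_derivative ::
  "(real^4^4 \<Rightarrow> 'b::real_normed_vector) \<Rightarrow> real \<Rightarrow> real \<Rightarrow> real^4^4 \<Rightarrow> real^4^4 \<Rightarrow> 'b" where
  "orb_derivative f c1 c2 M =
     restrict (frechet_derivative f (at M within orb c1 c2)) (orb_tangent M)"


section \<open>Lie algebras of operators on a subspace\<close>

text \<open>A linear operator on a subspace \<open>T\<close> is represented by a function that is extensional
  on \<open>T\<close>, so that equality of functions is equality of operators.\<close>

definition operators :: "'a::real_vector set \<Rightarrow> ('a \<Rightarrow> 'a) set" where
  "operators T = {A \<in> T \<rightarrow>\<^sub>E T. \<forall>u\<in>T. \<forall>v\<in>T. \<forall>r s.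
     A (r *\<^sub>R u + s *\<^sub>R v) = r *\<^sub>R A u + s *\<^sub>R A v}"

definition op_zero :: "'a::real_vector set \<Rightarrow> 'a \<Rightarrow> 'a" where
  "op_zero T = (\<lambda>v\<in>T. 0)"

definition op_add :: "'a::real_vector set \<Rightarrow> ('a \<Rightarrow> 'a) \<Rightarrow> ('a \<Rightarrow> 'a) \<Rightarrow> 'a \<Rightarrow> 'a" where
  "op_add T A B = (\<lambda>v\<in>T. A v + B v)"

definition op_scale :: "'a::real_vector set \<Rightarrow> real \<Rightarrow> ('a \<Rightarrow> 'a) \<Rightarrow> 'a \<Rightarrow> 'a" where
  "op_scale T r A = (\<lambda>v\<in>T. r *\<^sub>R A v)"

definition op_bracket :: "'a::real_vector set \<Rightarrow> ('a \<Rightarrow> 'a) \<Rightarrow> ('a \<Rightarrow> 'a) \<Rightarrow> 'a \<Rightarrow> 'a" where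
  "op_bracket T A B = (\<lambda>v\<in>T. A (B v) - B (A v))"

definition op_subspace :: "'a::real_vector set \<Rightarrow> ('a \<Rightarrow> 'a) set \<Rightarrow> bool" where
  "op_subspace T V \<longleftrightarrow> V \<subseteq> operators T \<and> op_zero T \<in> V \<and>
     (\<forall>A\<in>V. \<forall>B\<in>V. op_add T A B \<in> V) \<and> (\<forall>r. \<forall>A\<in>V. op_scale T r A \<in> V)"

definition op_span :: "'a::real_vector set \<Rightarrow> ('a \<Rightarrow> 'a) set \<Rightarrow> ('a \<Rightarrow> 'a) set" where
  "op_span T S = \<Inter>{V. op_subspace T V \<and> S \<subseteq> V}"

definition lie_algebra_of_ops :: "'a::real_vector set \<Rightarrow> ('a \<Rightarrow> 'a) set \<Rightarrow> bool" where
  "lie_algebra_of_ops T L \<longleftrightarrow> op_subspace T L \<and> (\<forall>A\<in>L. \<forall>B\<in>L. op_bracket T A B \<in> L)"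

definition lie_generated :: "'a::real_vector set \<Rightarrow> ('a \<Rightarrow> 'a) set \<Rightarrow> ('a \<Rightarrow> 'a) set" where
  "lie_generated T S = \<Inter>{L. lie_algebra_of_ops T L \<and> S \<subseteq> L}"

primrec lower_central ::
  "'a::real_vector set \<Rightarrow> ('a \<Rightarrow> 'a) set \<Rightarrow> nat \<Rightarrow> ('a \<Rightarrow> 'a) set" where
  "lower_central T L 0 = L"
| "lower_central T L (Suc k) =
     op_span T {op_bracket T A B | A B. A \<in> L \<and> B \<in> lower_central T L k}"

definition lie_nilpotent :: "'a::real_vector set \<Rightarrow> ('a \<Rightarrow> 'a) set \<Rightarrow> bool" where
  "lie_nilpotent T L \<longleftrightarrow> (\<exists>k. lower_central T L k = {op_zero T})"

text \<open>A Cartan subalgebra of \<open>L\<close> is a nilpotent subalgebra that is its own normalizer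
  in \<open>L\<close>.\<close>

definition cartan_subalgebra ::
  "'a::real_vector set \<Rightarrow> ('a \<Rightarrow> 'a) set \<Rightarrow> ('a \<Rightarrow> 'a) set \<Rightarrow> bool" where
  "cartan_subalgebra T L K \<longleftrightarrow> K \<subseteq> L \<and> lie_algebra_of_ops T K \<and> lie_nilpotent T K \<and>
     {A \<in> L. \<forall>B\<in>K. op_bracket T A B \<in> K} = K"

definition inf_symplectic ::
  "'a::real_vector set \<Rightarrow> ('a \<Rightarrow> 'a \<Rightarrow> real) \<Rightarrow> ('a \<Rightarrow> 'a) set" where
  "inf_symplectic T w = {A \<in> operators T. \<forall>u\<in>T. \<forall>v\<in>T. w (A u) v + w u (A v) = 0}"


section \<open>Non-degenerate equilibria and the center-center type\<close>

definition linearization_algebra ::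
  "(real^4^4 \<Rightarrow> real) \<Rightarrow> (real^4^4 \<Rightarrow> real) \<Rightarrow> real \<Rightarrow> real \<Rightarrow> real^4^4 \<Rightarrow>
   (real^4^4 \<Rightarrow> real^4^4) set" where
  "linearization_algebra F G c1 c2 M = lie_generated (orb_tangent M)
     {orb_derivative (hamiltonian_field F) c1 c2 M,
      orb_derivative (hamiltonian_field G) c1 c2 M}"

definition nondegenerate_equilibrium ::
  "(real^4^4 \<Rightarrow> real) \<Rightarrow> (real^4^4 \<Rightarrow> real) \<Rightarrow> real \<Rightarrow> real \<Rightarrow> real^4^4 \<Rightarrow> bool" where
  "nondegenerate_equilibrium F G c1 c2 M \<longleftrightarrow>
     M \<in> orb c1 c2 \<and> hamiltonian_field F M = 0 \<and>
     (\<forall>v\<in>orb_tangent M. orb_derivative F c1 c2 M v = 0) \<and>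
     (\<forall>v\<in>orb_tangent M. orb_derivative G c1 c2 M v = 0) \<and>
     cartan_subalgebra (orb_tangent M) (inf_symplectic (orb_tangent M) (orb_form M))
       (linearization_algebra F G c1 c2 M)"

definition canonical_form :: "real^4 \<Rightarrow> real^4 \<Rightarrow> real" where
  "canonical_form u v = u$1 * v$3 + u$2 * v$4 - u$3 * v$1 - u$4 * v$2"

definition center_center_matrices :: "(real^4^4) set" where
  "center_center_matrices = {vector [
     vector [0, 0, -A, 0],
     vector [0, 0, 0, -B],
     vector [A, 0, 0, 0],
     vector [0, B, 0, 0]] | A B. True}"

text \<open>Conjugacy is by a linear symplectic isomorphism \<open>\<phi>\<close> from the tangent space to
  the canonical symplectic space. Replacing \<^const>\<open>canonical_form\<close> by its negative gives the same
  notion: negating the last two coordinates changes the sign of the form and maps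
  \<^const>\<open>center_center_matrices\<close> to itself.\<close>

definition center_center_type ::
  "(real^4^4 \<Rightarrow> real) \<Rightarrow> (real^4^4 \<Rightarrow> real) \<Rightarrow> real \<Rightarrow> real \<Rightarrow> real^4^4 \<Rightarrow> bool" where
  "center_center_type F G c1 c2 M \<longleftrightarrow>
     (\<exists>\<phi>. linear \<phi> \<and> bij_betw \<phi> (orb_tangent M) UNIV \<and>
        (\<forall>u\<in>orb_tangent M. \<forall>v\<in>orb_tangent M. canonical_form (\<phi> u) (\<phi> v) = orb_form M u v) \<and>
        {N. \<exists>A\<in>linearization_algebra F G c1 c2 M.
              \<forall>v\<in>orb_tangent M. \<phi> (A v) = N *v \<phi> v} = center_center_matrices)"


section \<open>Lyapunov stability\<close>

definition solution_on ::
  "('a::real_normed_vector \<Rightarrow> 'a) \<Rightarrow> 'a set \<Rightarrow> real \<Rightarrow> (real \<Rightarrow> 'a) \<Rightarrow> bool" where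
  "solution_on f S T \<gamma> \<longleftrightarrow> (\<forall>t\<in>{0..T}. \<gamma> t \<in> S \<and>
     (\<gamma> has_vector_derivative f (\<gamma> t)) (at t within {0..T}))"

text \<open>Solutions on all compact time intervals are considered, so nothing is presupposed about
  the existence of solutions for all time.\<close>

definition lyapunov_stable ::
  "('a::real_normed_vector \<Rightarrow> 'a) \<Rightarrow> 'a set \<Rightarrow> 'a \<Rightarrow> bool" where
  "lyapunov_stable f S M \<longleftrightarrow> M \<in> S \<and> f M = 0 \<and>
     (\<forall>\<epsilon>>0. \<exists>\<delta>>0. \<forall>T\<ge>0. \<forall>\<gamma>. solution_on f S T \<gamma> \<and> dist (\<gamma> 0) M < \<delta> \<longrightarrow>
        (\<forall>t\<in>{0..T}. dist (\<gamma> t) M < \<epsilon>))"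

end

theory Submission
  imports Defs "HOL-Analysis.Cross3"
begin

text \<open>Every function in the theorem except \<open>C\<^sub>2\<close> is a diagonal quadratic form
\<open>\<Sum>\<^bsub>i<j\<^esub> f\<^sub>i\<^sub>j M\<^sub>i\<^sub>j\<^sup>2 / 2\<close>, and on \<^const>\<open>so4\<close> the gradient of such a form is a diagonal operator in the
coordinates \<open>(x, y)\<close>; the rigid body equation is the Hamiltonian field of the weights
\<open>1 / (\<lambda>\<^sub>i + \<lambda>\<^sub>j)\<close>. The proof rests on the pencil of first integrals \<open>F\<^sub>t\<close> with weights
\<open>(t - \<lambda>\<^sub>k\<^sup>2) (t - \<lambda>\<^sub>m\<^sup>2)\<close>, where \<open>k\<close> and \<open>m\<close> are the two indices different from \<open>i\<close> and \<open>j\<close>. For two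
parameters \<open>t \<noteq> t'\<close>, both \<open>H\<close> and \<open>I\<close> are combinations of \<open>F\<^sub>t\<close>, \<open>F\<^sub>t\<^sub>'\<close> and \<open>C\<^sub>1\<close>, and modulo
\<open>C\<^sub>1\<close> these combinations are independent (\<open>inverse_sum_via_complement\<close>,
\<open>affine_in_mode_weights\<close>).

Let \<open>M\<close> be the equilibrium with \<open>x\<^sub>1 = p\<close>, \<open>y\<^sub>1 = q\<close>, where \<open>q\<^sup>2 < p\<^sup>2\<close>. The parameters are chosen
as the roots of
\<open>p\<^sup>2 (t - \<lambda>\<^sub>1\<^sup>2) (t - \<lambda>\<^sub>4\<^sup>2) = q\<^sup>2 (t - \<lambda>\<^sub>2\<^sup>2) (t - \<lambda>\<^sub>3\<^sup>2)\<close>.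
The difference of the two sides has positive leading coefficient and is nonpositive at \<open>\<lambda>\<^sub>1\<^sup>2\<close> and
at \<open>\<lambda>\<^sub>4\<^sup>2\<close>, so there is one root \<open>t \<ge> \<lambda>\<^sub>1\<^sup>2\<close> and one root \<open>t' \<le> \<lambda>\<^sub>4\<^sup>2\<close>. Therefore all numbers
\<open>t - \<lambda>\<^sub>i\<^sup>2\<close> and \<open>\<lambda>\<^sub>i\<^sup>2 - t'\<close> are squares \<open>s\<^sub>i\<^sup>2\<close> and \<open>r\<^sub>i\<^sup>2\<close>; signs can be chosen such that
\<open>p s\<^sub>1 s\<^sub>4 = q s\<^sub>2 s\<^sub>3\<close> and \<open>p r\<^sub>1 r\<^sub>4 = q r\<^sub>2 r\<^sub>3\<close> (\<open>normal_modes_exist\<close>). Subtracting the right multiple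
of \<open>C\<^sub>2\<close> turns \<open>2 F\<^sub>t\<close> into a sum of three squares of linear functions
(\<open>mode_energy_squares\<close>), all of which vanish at \<open>M\<close>; the first involves only \<open>x\<^sub>1, y\<^sub>1\<close>, the
second, \<open>\<xi>\<close>, only \<open>x\<^sub>2, y\<^sub>2\<close>, and the third, \<open>\<eta>\<close>, only \<open>x\<^sub>3, y\<^sub>3\<close>. The same holds for
\<open>F\<^sub>t\<^sub>'\<close>.

Both assertions follow. The tangent space of the orbit at \<open>M\<close> has the coordinates
\<open>x\<^sub>2, x\<^sub>3, y\<^sub>2, y\<^sub>3\<close>, on which the two pairs \<open>(\<xi>, \<eta>)\<close> are symplectic coordinates up to
scaling (\<open>orb_form_modes\<close>). The linearization of the field of \<open>F\<^sub>t\<close> rotates its own pair and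
annihilates the other one (\<open>chart_linearized_field\<close>), so the linearizations of the fields of \<open>H\<close> and
\<open>I\<close> span all the center-center matrices, which form a Cartan subalgebra
(\<open>center_center_cartan\<close>). For the stability, the sum of the two sums of squares plus
\<open>(C\<^sub>1 - c\<^sub>1)\<^sup>2\<close> is a nonnegative first integral on all of \<^const>\<open>so4\<close> whose only zeros are \<open>M\<close> and
\<open>- M\<close> (\<open>mode_energy_zero\<close>). It is a Lyapunov function, and stability on the orbit is
a special case of stability on \<^const>\<open>so4\<close>.\<close>

section \<open>Coordinates on so(4) and derivatives within subsets\<close>

lemma vector_4_nth [simp]:
  "(vector [a, b, c, d] :: 'a::zero^4) $ 1 = a"
  "(vector [a, b, c, d] :: 'a::zero^4) $ 2 = b"
  "(vector [a, b, c, d] :: 'a::zero^4) $ 3 = c"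
  "(vector [a, b, c, d] :: 'a::zero^4) $ 4 = d"
  by (simp_all add: vector_def)

lemma vec_3_eq_iff: "(u :: 'a^3) = v \<longleftrightarrow> u$1 = v$1 \<and> u$2 = v$2 \<and> u$3 = v$3"
  unfolding vec_eq_iff forall_3 by (rule refl)

lemma vec_4_eq_iff: "(u :: 'a^4) = v \<longleftrightarrow> u$1 = v$1 \<and> u$2 = v$2 \<and> u$3 = v$3 \<and> u$4 = v$4"
  unfolding vec_eq_iff forall_4 by (rule refl)

lemma x_coords_so4_matrix [simp]: "x_coords (so4_matrix x y) = x"
  and y_coords_so4_matrix [simp]: "y_coords (so4_matrix x y) = y"
  by (simp_all add: x_coords_def y_coords_def so4_matrix_def vec_eq_iff forall_3)

lemma so4_matrix_nth [simp]:
  "so4_matrix x y $ 1 $ 1 = 0" "so4_matrix x y $ 1 $ 2 = - x$3"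
  "so4_matrix x y $ 1 $ 3 = x$2" "so4_matrix x y $ 1 $ 4 = y$1"
  "so4_matrix x y $ 2 $ 1 = x$3" "so4_matrix x y $ 2 $ 2 = 0"
  "so4_matrix x y $ 2 $ 3 = - x$1" "so4_matrix x y $ 2 $ 4 = y$2"
  "so4_matrix x y $ 3 $ 1 = - x$2" "so4_matrix x y $ 3 $ 2 = x$1"
  "so4_matrix x y $ 3 $ 3 = 0" "so4_matrix x y $ 3 $ 4 = y$3"
  "so4_matrix x y $ 4 $ 1 = - y$1" "so4_matrix x y $ 4 $ 2 = - y$2"
  "so4_matrix x y $ 4 $ 3 = - y$3" "so4_matrix x y $ 4 $ 4 = 0"
  unfolding so4_matrix_def vector_4_nth by (rule refl)+

lemma matrix_4_eq_iff:
  "(M :: 'a^4^4) = N \<longleftrightarrow>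
    (M$1$1 = N$1$1 \<and> M$1$2 = N$1$2 \<and> M$1$3 = N$1$3 \<and> M$1$4 = N$1$4) \<and>
    (M$2$1 = N$2$1 \<and> M$2$2 = N$2$2 \<and> M$2$3 = N$2$3 \<and> M$2$4 = N$2$4) \<and>
    (M$3$1 = N$3$1 \<and> M$3$2 = N$3$2 \<and> M$3$3 = N$3$3 \<and> M$3$4 = N$3$4) \<and>
    (M$4$1 = N$4$1 \<and> M$4$2 = N$4$2 \<and> M$4$3 = N$4$3 \<and> M$4$4 = N$4$4)"
  unfolding vec_eq_iff forall_4 by (rule refl)

lemma in_so4_iff: "M \<in> so4 \<longleftrightarrow> (\<forall>i j. M $ j $ i = - M $ i $ j)"
  unfolding so4_def mem_Collect_eq vec_eq_iff by (simp only: transpose_def vec_lambda_beta uminus_vec_def)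

lemma so4_matrix_in_so4 [simp]: "so4_matrix x y \<in> so4"
  unfolding so4_def mem_Collect_eq matrix_4_eq_iff by (simp add: transpose_def)

lemma so4_matrix_coords: "so4_matrix (x_coords M) (y_coords M) = M" if "M \<in> so4"
proof -
  have "M $ j $ i = - M $ i $ j" for i j
    using that unfolding in_so4_iff by blast
  from this[of 1 1] this[of 2 2] this[of 3 3] this[of 4 4] this[of 2 1] this[of 3 1] this[of 4 1]
    this[of 3 2] this[of 4 2] this[of 4 3]
  show ?thesis
    unfolding matrix_4_eq_iff by (simp add: x_coords_def y_coords_def)
qed

lemma so4_cases:
  assumes "M \<in> so4"
  obtains x y where "M = so4_matrix x y"
  using so4_matrix_coords[OF assms] by metis

lemma so4_matrix_eq_iff [simp]: "so4_matrix x y = so4_matrix x' y' \<longleftrightarrow> x = x' \<and> y = y'"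
  by (metis x_coords_so4_matrix y_coords_so4_matrix)

lemma so4_matrix_add: "so4_matrix x y + so4_matrix x' y' = so4_matrix (x + x') (y + y')"
  and so4_matrix_diff: "so4_matrix x y - so4_matrix x' y' = so4_matrix (x - x') (y - y')"
  and so4_matrix_scale: "c *\<^sub>R so4_matrix x y = so4_matrix (c *\<^sub>R x) (c *\<^sub>R y)"
  and so4_matrix_zero: "so4_matrix 0 0 = 0"
  unfolding matrix_4_eq_iff by simp_all

lemma subspace_so4: "subspace so4"
  by (metis (no_types, lifting) so4_cases so4_matrix_add so4_matrix_in_so4 so4_matrix_scale
      so4_matrix_zero subspace_def)

lemma linear_x_coords: "linear x_coords" and linear_y_coords: "linear y_coords"
  by (auto intro!: linearI simp: x_coords_def y_coords_def vec_eq_iff forall_3)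

lemmas bounded_linear_x_coords = linear_conv_bounded_linear[THEN iffD1, OF linear_x_coords]
lemmas bounded_linear_y_coords = linear_conv_bounded_linear[THEN iffD1, OF linear_y_coords]

text \<open>In block form the matrix of \<open>(x, y)\<close> is \<open>[hat x, y; - y\<^sup>T, 0]\<close>, where \<open>hat x\<close> is the
  matrix of the cross product with \<open>x\<close>.\<close>

lemma lie_bracket_so4_matrix:
  "lie_bracket (so4_matrix x y) (so4_matrix x' y') = so4_matrix (cross3 x x' + cross3 y y') (cross3 x y' + cross3 y x')"
  unfolding matrix_4_eq_iff
  by (simp add: lie_bracket_def matrix_matrix_mult_def sum_4 cross3_def algebra_simps)

lemma so4_inner_so4_matrix:
  "so4_inner (so4_matrix x y) (so4_matrix x' y') = x \<bullet> x' + y \<bullet> y'"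
  by (simp add: so4_inner_def trace_def matrix_matrix_mult_def sum_4 inner_vec_def
     sum_3 algebra_simps)

lemma lie_bracket_in_so4: "lie_bracket X Y \<in> so4" if "X \<in> so4" "Y \<in> so4"
  using that by (metis so4_cases lie_bracket_so4_matrix so4_matrix_in_so4)

lemma bounded_bilinear_lie_bracket: "bounded_bilinear lie_bracket"
proof -
  have "bilinear lie_bracket"
    unfolding bilinear_def lie_bracket_def
    by (auto intro!: linearI simp: vec_eq_iff matrix_matrix_mult_def sum.distrib sum_distrib_left
        sum_subtractf algebra_simps)
  then show ?thesis by (simp add: bilinear_conv_bounded_bilinear)
qed

lemma bounded_linear_so4_inner: "bounded_linear (so4_inner X)"
  unfolding linear_conv_bounded_linear[symmetric] so4_inner_def trace_def matrix_matrix_mult_def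
  by (auto intro!: linearI simp: sum_4 field_simps)

text \<open>A derivative within a set need not be unique, but its value on the velocity of a curve in
the set is, because there it computes the derivative of the composition with the curve.\<close>

lemma has_derivative_within_unique_along_curve:
  fixes f :: "'a::real_normed_vector \<Rightarrow> 'b::real_normed_vector" and \<gamma> :: "real \<Rightarrow> 'a"
  assumes D: "(f has_derivative D) (at x within S)" and E: "(f has_derivative E) (at x within S)"
    and \<gamma>: "(\<gamma> has_vector_derivative v) (at 0)" and "\<gamma> 0 = x" and S: "\<And>t. \<gamma> t \<in> S"
  shows "D v = E v"
proof -
  have *: "((\<lambda>t. f (\<gamma> t)) has_derivative (\<lambda>h. F (h *\<^sub>R v))) (at 0)"
    if "(f has_derivative F) (at x within S)" for F
  proof (rule has_derivative_in_compose[of \<gamma>])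
    show "(\<gamma> has_derivative (\<lambda>h. h *\<^sub>R v)) (at 0)"
      using \<gamma> by (simp add: has_vector_derivative_def)
    show "(f has_derivative F) (at (\<gamma> 0) within range \<gamma>)"
      using that S unfolding \<open>\<gamma> 0 = x\<close> by (elim has_derivative_subset) auto
  qed
  have "(\<lambda>h. D (h *\<^sub>R v)) = (\<lambda>h. E (h *\<^sub>R v))"
    using *[OF D] *[OF E] by (rule has_derivative_unique)
  from fun_cong[OF this, of 1] show ?thesis by simp
qed

text \<open>Within a subspace, difference quotients evaluate the derivative only on vectors of the subspace.
This allows derivatives computed in the ambient matrix space to be rewritten as inner products
on \<^const>\<open>so4\<close>.\<close>

lemma has_derivative_within_subspace_cong:
  fixes f :: "'a::real_normed_vector \<Rightarrow> 'b::real_normed_vector"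
  assumes D: "(f has_derivative D) (at x within S)" and "subspace S" "x \<in> S"
    and "bounded_linear E" and eq: "\<And>v. v \<in> S \<Longrightarrow> D v = E v"
  shows "(f has_derivative E) (at x within S)"
proof -
  have "((\<lambda>y. (f y - f x - D (y - x)) /\<^sub>R norm (y - x)) \<longlongrightarrow> 0) (at x within S)"
    using D by (simp add: has_derivative_at_within)
  moreover have "\<forall>\<^sub>F y in at x within S. (f y - f x - D (y - x)) /\<^sub>R norm (y - x) =
      (f y - f x - E (y - x)) /\<^sub>R norm (y - x)"
    unfolding eventually_at_filter
  proof (intro always_eventually allI impI)
    fix y assume "y \<in> S"
    then have "D (y - x) = E (y - x)" by (intro eq subspace_diff assms)
    then show "(f y - f x - D (y - x)) /\<^sub>R norm (y - x) = (f y - f x - E (y - x)) /\<^sub>R norm (y - x)"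
      by simp
  qed
  ultimately show ?thesis
    unfolding has_derivative_at_within by (simp add: assms(4) cong: tendsto_cong)
qed

section \<open>Diagonal quadratic Hamiltonians\<close>

text \<open>A weight \<open>f\<close> is a function of a pair of indices; the entry \<open>M\<^sub>i\<^sub>j\<close> with \<open>i < j\<close> is multiplied by
\<open>f i j\<close>. Thus \<open>x\<^sub>1, x\<^sub>2, x\<^sub>3\<close> belong to the pairs \<open>23, 13, 12\<close> and \<open>y\<^sub>k\<close> belongs to \<open>k4\<close>.\<close>

definition diagonal_operator :: "(4 \<Rightarrow> 4 \<Rightarrow> real) \<Rightarrow> real^4^4 \<Rightarrow> real^4^4" where
  "diagonal_operator f M = so4_matrix
     (vector [f 2 3 * x_coords M $ 1, f 1 3 * x_coords M $ 2, f 1 2 * x_coords M $ 3])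
     (vector [f 1 4 * y_coords M $ 1, f 2 4 * y_coords M $ 2, f 3 4 * y_coords M $ 3])"

definition diagonal_form :: "(4 \<Rightarrow> 4 \<Rightarrow> real) \<Rightarrow> real^4^4 \<Rightarrow> real" where
  "diagonal_form f M =
     (f 2 3 * (x_coords M $ 1)^2 + f 1 3 * (x_coords M $ 2)^2 + f 1 2 * (x_coords M $ 3)^2
    + f 1 4 * (y_coords M $ 1)^2 + f 2 4 * (y_coords M $ 2)^2 + f 3 4 * (y_coords M $ 3)^2) / 2"

lemma energy_eq_diagonal_form: "energy l = diagonal_form (\<lambda>i j. 1 / (l$i + l$j))"
  by (simp add: fun_eq_iff energy_def diagonal_form_def Let_def)

lemma integral_I_eq_diagonal_form: "integral_I l = diagonal_form (\<lambda>i j. 2 * ((l$i)^2 + (l$j)^2))"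
  by (simp add: fun_eq_iff integral_I_def diagonal_form_def Let_def algebra_simps)

lemma casimir1_eq_diagonal_form: "casimir1 = diagonal_form (\<lambda>i j. 1)"
  by (simp add: fun_eq_iff casimir1_def diagonal_form_def sum_3 algebra_simps)

lemma diagonal_operator_in_so4 [simp]: "diagonal_operator f M \<in> so4"
  by (simp add: diagonal_operator_def)

lemma linear_diagonal_operator: "linear (diagonal_operator f)"
  by (rule linearI) (simp_all add: diagonal_operator_def so4_matrix_add so4_matrix_scale
      vec_3_eq_iff linear_add[OF linear_x_coords] linear_add[OF linear_y_coords]
      linear_scale[OF linear_x_coords] linear_scale[OF linear_y_coords] algebra_simps)

lemma bounded_linear_diagonal_operator: "bounded_linear (diagonal_operator f)"
  using linear_diagonal_operator by (simp add: linear_conv_bounded_linear)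

lemma diagonal_form_has_derivative:
  assumes "M \<in> so4"
  shows "(diagonal_form f has_derivative so4_inner (diagonal_operator f M)) (at M within so4)"
proof -
  have x: "((\<lambda>N. x_coords N $ i) has_derivative (\<lambda>X. x_coords X $ i)) (at M within so4)" for i
    by (intro bounded_linear_imp_has_derivative bounded_linear_compose[OF bounded_linear_vec_nth]
        bounded_linear_x_coords)
  have y: "((\<lambda>N. y_coords N $ i) has_derivative (\<lambda>X. y_coords X $ i)) (at M within so4)" for i
    by (intro bounded_linear_imp_has_derivative bounded_linear_compose[OF bounded_linear_vec_nth]
        bounded_linear_y_coords)
  have "(diagonal_form f has_derivative (\<lambda>X.
      f 2 3 * x_coords M $ 1 * x_coords X $ 1 + f 1 3 * x_coords M $ 2 * x_coords X $ 2
      + f 1 2 * x_coords M $ 3 * x_coords X $ 3 + f 1 4 * y_coords M $ 1 * y_coords X $ 1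
      + f 2 4 * y_coords M $ 2 * y_coords X $ 2 + f 3 4 * y_coords M $ 3 * y_coords X $ 3))
      (at M within so4)"
    unfolding diagonal_form_def [abs_def]
    by (auto intro!: derivative_eq_intros x y simp: field_simps)
  then show ?thesis
  proof (rule has_derivative_within_subspace_cong[OF _ subspace_so4 assms bounded_linear_so4_inner])
    fix X :: "real^4^4" assume "X \<in> so4"
    then obtain x y where "X = so4_matrix x y" by (rule so4_cases)
    then show "f 2 3 * x_coords M $ 1 * x_coords X $ 1 + f 1 3 * x_coords M $ 2 * x_coords X $ 2
      + f 1 2 * x_coords M $ 3 * x_coords X $ 3 + f 1 4 * y_coords M $ 1 * y_coords X $ 1
      + f 2 4 * y_coords M $ 2 * y_coords X $ 2 + f 3 4 * y_coords M $ 3 * y_coords X $ 3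
      = so4_inner (diagonal_operator f M) X"
      by (simp add: diagonal_operator_def so4_inner_so4_matrix inner_vec_def sum_3)
  qed
qed

lemma so4_inner_nondegenerate:
  assumes "G \<in> so4" "G' \<in> so4" and eq: "\<And>X. X \<in> so4 \<Longrightarrow> so4_inner G X = so4_inner G' X"
  shows "G = G'"
proof -
  obtain x y x' y' where [simp]: "G = so4_matrix x y" "G' = so4_matrix x' y'"
    using assms by (metis so4_cases)
  have "x \<bullet> u + y \<bullet> v = x' \<bullet> u + y' \<bullet> v" for u v
    using eq[of "so4_matrix u v"] by (simp add: so4_inner_so4_matrix)
  then have "x = x'" "y = y'"
    using vector_eq_rdot by (metis add_cancel_right_right inner_zero_right add_0)+
  then show ?thesis by simp
qed

lemma so4_gradient_diagonal_form:
  assumes M: "M \<in> so4"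
  shows "so4_gradient (diagonal_form f) M = diagonal_operator f M"
  unfolding so4_gradient_def
proof (rule the_equality)
  show "diagonal_operator f M \<in> so4 \<and>
      (diagonal_form f has_derivative so4_inner (diagonal_operator f M)) (at M within so4)"
    using diagonal_form_has_derivative[OF M] by simp
next
  fix G assume G: "G \<in> so4 \<and> (diagonal_form f has_derivative so4_inner G) (at M within so4)"
  have "so4_inner G X = so4_inner (diagonal_operator f M) X" if X: "X \<in> so4" for X
  proof (rule has_derivative_within_unique_along_curve[where D = "so4_inner G"])
    show "(diagonal_form f has_derivative so4_inner G) (at M within so4)" using G by simp
    show "(diagonal_form f has_derivative so4_inner (diagonal_operator f M)) (at M within so4)"
      by (rule diagonal_form_has_derivative[OF M])
    show "((\<lambda>t. M + t *\<^sub>R X) has_vector_derivative X) (at 0)"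
      by (auto intro!: derivative_eq_intros)
    show "M + t *\<^sub>R X \<in> so4" for t
      using M X subspace_so4 by (simp add: subspace_add subspace_mul)
  qed simp
  then show "G = diagonal_operator f M"
    using G by (intro so4_inner_nondegenerate) auto
qed

definition diagonal_field :: "(4 \<Rightarrow> 4 \<Rightarrow> real) \<Rightarrow> real^4^4 \<Rightarrow> real^4^4" where
  "diagonal_field f M = lie_bracket M (diagonal_operator f M)"

lemma hamiltonian_field_diagonal_form:
  "M \<in> so4 \<Longrightarrow> hamiltonian_field (diagonal_form f) M = diagonal_field f M"
  by (simp add: hamiltonian_field_def diagonal_field_def so4_gradient_diagonal_form)

lemma diagonal_times_plus_times_diagonal:
  "(diag_matrix l ** W + W ** diag_matrix l) $ i $ j = (l$i + l$j) * W $ i $ j"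
  by (simp add: matrix_matrix_mult_def diag_matrix_def mult_delta_left mult_delta_right algebra_simps)

text \<open>The entries \<open>W\<^sub>i\<^sub>j\<close> off the diagonal are determined by \<open>M\<^sub>i\<^sub>j = (\<lambda>\<^sub>i + \<lambda>\<^sub>j) W\<^sub>i\<^sub>j\<close>. On the diagonal the
equation may be degenerate, since \<open>\<lambda>\<^sub>4\<close> may vanish, but there antisymmetry forces \<open>W\<^sub>i\<^sub>i = 0\<close>.\<close>

lemma angular_velocity_eq_diagonal_operator:
  assumes l: "\<And>i j. i \<noteq> j \<Longrightarrow> l$i + l$j > 0" and "M \<in> so4"
  shows "angular_velocity l M = diagonal_operator (\<lambda>i j. 1 / (l$i + l$j)) M"
proof -
  obtain x y where M: "M = so4_matrix x y" using assms by (metis so4_cases)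
  have l': "l$i + l$j \<noteq> 0" if "i \<noteq> j" for i j using l[OF that] by simp
  have nz: "l$1 + l$2 \<noteq> 0" "l$1 + l$3 \<noteq> 0" "l$1 + l$4 \<noteq> 0" "l$2 + l$3 \<noteq> 0" "l$2 + l$4 \<noteq> 0"
    "l$3 + l$4 \<noteq> 0"
    by (rule l'; simp)+
  have "so4_matrix x y = diag_matrix l ** so4_matrix x' y' + so4_matrix x' y' ** diag_matrix l \<longleftrightarrow>
      x = vector [(l$2 + l$3) * x'$1, (l$1 + l$3) * x'$2, (l$1 + l$2) * x'$3] \<and>
      y = vector [(l$1 + l$4) * y'$1, (l$2 + l$4) * y'$2, (l$3 + l$4) * y'$3]" for x' y'
    unfolding matrix_4_eq_iff diagonal_times_plus_times_diagonal
    by (auto simp: vec_3_eq_iff algebra_simps)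
  also have "\<dots> x' y' \<longleftrightarrow>  so4_matrix x' y' = diagonal_operator (\<lambda>i j. 1 / (l$i + l$j)) M" for x' y'
    using nz by (auto simp: M diagonal_operator_def vec_3_eq_iff field_simps)
  finally have *: "so4_matrix x y = diag_matrix l ** so4_matrix x' y' + so4_matrix x' y' ** diag_matrix l \<longleftrightarrow>
     so4_matrix x' y' = diagonal_operator (\<lambda>i j. 1 / (l$i + l$j)) M" for x' y' .
  show ?thesis
    unfolding angular_velocity_def M[symmetric]
  proof (rule the_equality)
    show "diagonal_operator (\<lambda>i j. 1 / (l$i + l$j)) M \<in> so4 \<and>
      M = diag_matrix l ** diagonal_operator (\<lambda>i j. 1 / (l$i + l$j)) M +
        diagonal_operator (\<lambda>i j. 1 / (l$i + l$j)) M ** diag_matrix l"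
      using * by (metis M diagonal_operator_in_so4 so4_cases)
    show "W = diagonal_operator (\<lambda>i j. 1 / (l$i + l$j)) M"
      if "W \<in> so4 \<and> M = diag_matrix l ** W + W ** diag_matrix l" for W
      using that * by (metis M so4_cases)
  qed
qed

lemma rigid_body_eq_diagonal_field:
  assumes "\<And>i j. i \<noteq> j \<Longrightarrow> l$i + l$j > 0" and "M \<in> so4"
  shows "rigid_body l M = diagonal_field (\<lambda>i j. 1 / (l$i + l$j)) M"
  using angular_velocity_eq_diagonal_operator[OF assms] by (simp add: rigid_body_def diagonal_field_def)

section \<open>Tangent space, symplectic form and linearization at the equilibrium\<close>

lemma has_vector_derivative_so4_matrix:
  assumes "\<And>i. ((\<lambda>t. x t $ i) has_real_derivative x' $ i) F"
    and "\<And>i. ((\<lambda>t. y t $ i) has_real_derivative y' $ i) F"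
  shows "((\<lambda>t. so4_matrix (x t) (y t)) has_vector_derivative so4_matrix x' y') F"
proof -
  have eq: "so4_matrix u v = (\<Sum>i\<in>UNIV. u $ i *\<^sub>R so4_matrix (axis i 1) 0 + v $ i *\<^sub>R so4_matrix 0 (axis i 1))"
    for u v
    by (simp add: so4_matrix_scale so4_matrix_add sum_3 vec_3_eq_iff axis_def)
  have "((\<lambda>t. \<Sum>i\<in>UNIV. x t $ i *\<^sub>R so4_matrix (axis i 1) 0 + y t $ i *\<^sub>R so4_matrix 0 (axis i 1))
      has_vector_derivative
      (\<Sum>i\<in>UNIV. x' $ i *\<^sub>R so4_matrix (axis i 1) 0 + y' $ i *\<^sub>R so4_matrix 0 (axis i 1))) F"
    by (intro has_vector_derivative_sum has_vector_derivative_add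
        bounded_linear.has_vector_derivative[OF bounded_linear_scaleR_left]
        assms[unfolded has_real_derivative_iff_has_vector_derivative])
  then show ?thesis unfolding eq[symmetric] .
qed

lemma casimir1_so4_matrix: "casimir1 (so4_matrix x y) = (x \<bullet> x + y \<bullet> y) / 2"
  and casimir2_so4_matrix: "casimir2 (so4_matrix x y) = x \<bullet> y"
  by (simp_all add: casimir1_def casimir2_def inner_vec_def power2_eq_square)

lemma M1_in_orb_iff: "M1 p q \<in> orb c1 c2 \<longleftrightarrow> c1 = (p\<^sup>2 + q\<^sup>2) / 2 \<and> c2 = p * q"
  by (auto simp: orb_def M1_def casimir1_so4_matrix casimir2_so4_matrix inner_vec_def sum_3
      power2_eq_square)

lemma M1_in_so4 [simp]: "M1 p q \<in> so4"
  by (simp add: M1_def)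

definition tangent_vector :: "real \<Rightarrow> real \<Rightarrow> real \<Rightarrow> real \<Rightarrow> real^4^4" where
  "tangent_vector x\<^sub>2 x\<^sub>3 y\<^sub>2 y\<^sub>3 = so4_matrix (vector [0, x\<^sub>2, x\<^sub>3]) (vector [0, y\<^sub>2, y\<^sub>3])"

lemma tangent_vector_eq_iff [simp]:
  "tangent_vector a b c d = tangent_vector a' b' c' d' \<longleftrightarrow> a = a' \<and> b = b' \<and> c = c' \<and> d = d'"
  by (auto simp: tangent_vector_def vec_3_eq_iff)

lemma tangent_vector_linear:
  "tangent_vector a b c d + tangent_vector a' b' c' d' = tangent_vector (a + a') (b + b') (c + c') (d + d')"
  "r *\<^sub>R tangent_vector a b c d = tangent_vector (r * a) (r * b) (r * c) (r * d)"
  "tangent_vector 0 0 0 0 = 0"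
  by (simp_all add: tangent_vector_def so4_matrix_add so4_matrix_scale vec_3_eq_iff flip: so4_matrix_zero)

lemma M1_bracket:
  "lie_bracket (M1 p q) (so4_matrix x y) =
     tangent_vector (- (p * x$3 + q * y$3)) (p * x$2 + q * y$2) (- (p * y$3 + q * x$3)) (p * y$2 + q * x$2)"
  by (simp add: M1_def lie_bracket_so4_matrix tangent_vector_def cross3_def vec_3_eq_iff)

lemma orb_tangent_M1:
  assumes "q\<^sup>2 < p\<^sup>2"
  shows "orb_tangent (M1 p q) = {tangent_vector a b c d | a b c d. True}"
proof -
  have "\<exists>X\<in>so4. tangent_vector a b c d = lie_bracket (M1 p q) X" for a b c d
  proof
    let ?D = "p\<^sup>2 - q\<^sup>2"
    let ?X = "so4_matrix (vector [0, (p * b - q * d) / ?D, (q * c - p * a) / ?D])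
      (vector [0, (p * d - q * b) / ?D, (q * a - p * c) / ?D])"
    have "?D \<noteq> 0" using assms by simp
    then show "tangent_vector a b c d = lie_bracket (M1 p q) ?X"
      unfolding M1_bracket by (simp add: divide_simps) (simp add: algebra_simps power2_eq_square)
  qed simp
  then show ?thesis
    unfolding orb_tangent_def by (blast elim: so4_cases intro: M1_bracket)
qed

text \<open>For \<open>u = [M, X]\<close> and \<open>v = [M, Y]\<close> the tangent vectors are linear in the components of \<open>X\<close> and \<open>Y\<close>
with indices \<open>2\<close> and \<open>3\<close>, through the matrix with rows \<open>(p, q)\<close> and \<open>(q, p)\<close>. Its determinant
\<open>p\<^sup>2 - q\<^sup>2\<close> is the denominator. In particular the value is the same for all representatives.\<close>

lemma orb_form_M1:
  assumes "q\<^sup>2 < p\<^sup>2"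
  shows "orb_form (M1 p q) (tangent_vector a b c d) (tangent_vector a' b' c' d') =
     (q * (a * d' - d * a' + c * b' - b * c') - p * (a * b' - b * a' + c * d' - d * c')) / (p\<^sup>2 - q\<^sup>2)"
    (is "_ = ?r")
proof -
  have D: "p\<^sup>2 - q\<^sup>2 \<noteq> 0" using assms by simp
  have *: "trace (M1 p q ** lie_bracket X Y) / 2 = ?r"
    if so4: "X \<in> so4" "Y \<in> so4" and u: "tangent_vector a b c d = lie_bracket (M1 p q) X"
      and v: "tangent_vector a' b' c' d' = lie_bracket (M1 p q) Y" for X Y
  proof -
    obtain x y x' y' where X: "X = so4_matrix x y" and Y: "Y = so4_matrix x' y'"
      using so4 by (metis so4_cases)
    have u_eqs: "a = - (p * x$3 + q * y$3)" "b = p * x$2 + q * y$2" "c = - (p * y$3 + q * x$3)"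
      "d = p * y$2 + q * x$2"
      using u unfolding X M1_bracket by auto
    have v_eqs: "a' = - (p * x'$3 + q * y'$3)" "b' = p * x'$2 + q * y'$2" "c' = - (p * y'$3 + q * x'$3)"
      "d' = p * y'$2 + q * x'$2"
      using v unfolding Y M1_bracket by auto
    have "trace (M1 p q ** lie_bracket X Y) / 2 = - so4_inner (M1 p q) (lie_bracket X Y)"
      by (simp add: so4_inner_def)
    also have "\<dots> = - (p * (x$2 * x'$3 - x$3 * x'$2 + y$2 * y'$3 - y$3 * y'$2)
        + q * (x$2 * y'$3 - x$3 * y'$2 + y$2 * x'$3 - y$3 * x'$2))"
      unfolding X Y lie_bracket_so4_matrix M1_def so4_inner_so4_matrix
      by (simp add: inner_vec_def sum_3 cross3_def algebra_simps)
    also have "\<dots> = ?r"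
    proof -
      have "q * (a * d' - d * a' + c * b' - b * c') - p * (a * b' - b * a' + c * d' - d * c') =
        - (p * (x$2 * x'$3 - x$3 * x'$2 + y$2 * y'$3 - y$3 * y'$2)
        + q * (x$2 * y'$3 - x$3 * y'$2 + y$2 * x'$3 - y$3 * x'$2)) * (p\<^sup>2 - q\<^sup>2)"
        unfolding u_eqs v_eqs by algebra
      then show ?thesis using D by (metis nonzero_eq_divide_eq)
    qed
    finally show ?thesis .
  qed
  have T: "tangent_vector e f g h \<in> orb_tangent (M1 p q)" for e f g h
    using orb_tangent_M1[OF assms] by auto
  obtain X Y where XY: "X \<in> so4" "Y \<in> so4" "tangent_vector a b c d = lie_bracket (M1 p q) X"
      "tangent_vector a' b' c' d' = lie_bracket (M1 p q) Y"
    using T[of a b c d] T[of a' b' c' d'] unfolding orb_tangent_def by auto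
  show ?thesis
    unfolding orb_form_def
  proof (rule the_equality)
    show "\<exists>X\<in>so4. \<exists>Y\<in>so4. tangent_vector a b c d = lie_bracket (M1 p q) X \<and>
      tangent_vector a' b' c' d' = lie_bracket (M1 p q) Y \<and> ?r = trace (M1 p q ** lie_bracket X Y) / 2"
      using XY *[OF XY] by metis
  qed (use * in blast)
qed

text \<open>Inverse stereographic projection of a straight line: a curve on the sphere of radius \<open>\<bar>R\<bar>\<close> that
starts at \<open>(R, 0, 0)\<close> with velocity \<open>(0, a, b)\<close> and is a rational function of the time.\<close>

definition sphere_curve :: "real \<Rightarrow> real \<Rightarrow> real \<Rightarrow> real \<Rightarrow> real^3" where
  "sphere_curve R a b t = (let m = (a\<^sup>2 + b\<^sup>2) / (4 * R\<^sup>2) in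
     vector [R * (1 - m * t\<^sup>2) / (1 + m * t\<^sup>2), t * a / (1 + m * t\<^sup>2), t * b / (1 + m * t\<^sup>2)])"

text \<open>Calculations with the curve use a name for the constant \<open>m\<close>, because its fraction, once
unfolded, is distributed over every term.\<close>

lemma sphere_curve_eq:
  obtains m where "m \<ge> 0" "R \<noteq> 0 \<Longrightarrow> a\<^sup>2 + b\<^sup>2 = 4 * R\<^sup>2 * m"
    "\<And>t. sphere_curve R a b t $ 1 = R * (1 - m * t\<^sup>2) / (1 + m * t\<^sup>2)"
    "\<And>t. sphere_curve R a b t $ 2 = t * a / (1 + m * t\<^sup>2)"
    "\<And>t. sphere_curve R a b t $ 3 = t * b / (1 + m * t\<^sup>2)"
  by (rule that[of "(a\<^sup>2 + b\<^sup>2) / (4 * R\<^sup>2)"]) (simp_all add: sphere_curve_def Let_def)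

lemma sphere_curve_norm:
  assumes "R \<noteq> 0"
  shows "sphere_curve R a b t \<bullet> sphere_curve R a b t = R\<^sup>2"
proof -
  obtain m where m: "m \<ge> 0" "a\<^sup>2 + b\<^sup>2 = 4 * R\<^sup>2 * m"
    and c: "sphere_curve R a b t $ 1 = R * (1 - m * t\<^sup>2) / (1 + m * t\<^sup>2)"
    "sphere_curve R a b t $ 2 = t * a / (1 + m * t\<^sup>2)"
    "sphere_curve R a b t $ 3 = t * b / (1 + m * t\<^sup>2)"
    using sphere_curve_eq[of R a b] assms by metis
  have "m * t\<^sup>2 \<ge> 0" using m by simp
  then have pos: "1 + m * t\<^sup>2 \<noteq> 0" by linarith
  have "sphere_curve R a b t \<bullet> sphere_curve R a b t =
      (R\<^sup>2 * (1 - m * t\<^sup>2)\<^sup>2 + t\<^sup>2 * (a\<^sup>2 + b\<^sup>2)) / (1 + m * t\<^sup>2)\<^sup>2"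
    unfolding inner_vec_def sum_3 c inner_real_def power2_eq_square[symmetric]
    by (simp add: power_mult_distrib power_divide add_divide_distrib distrib_left)
  also have "R\<^sup>2 * (1 - m * t\<^sup>2)\<^sup>2 + t\<^sup>2 * (a\<^sup>2 + b\<^sup>2) = R\<^sup>2 * (1 + m * t\<^sup>2)\<^sup>2"
    unfolding m by (simp add: power2_eq_square algebra_simps)
  finally show ?thesis using pos by simp
qed

lemma sphere_curve_0: "sphere_curve R a b 0 = vector [R, 0, 0]"
  by (simp add: sphere_curve_def Let_def)

lemma sphere_curve_derivative:
  "((\<lambda>t. sphere_curve R a b t $ i) has_real_derivative vector [0, a, b] $ i) (at 0)"
proof -
  obtain m where c: "\<And>t. sphere_curve R a b t $ 1 = R * (1 - m * t\<^sup>2) / (1 + m * t\<^sup>2)"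
    "\<And>t. sphere_curve R a b t $ 2 = t * a / (1 + m * t\<^sup>2)"
    "\<And>t. sphere_curve R a b t $ 3 = t * b / (1 + m * t\<^sup>2)"
    using sphere_curve_eq[of R a b] by metis
  consider "i = 1" | "i = 2" | "i = 3" using exhaust_3[of i] by blast
  then show ?thesis
    by cases (simp_all add: c, (auto intro!: derivative_eq_intros)+)
qed

text \<open>In the coordinates \<open>z = x + y\<close> and \<open>w = x - y\<close>, which split so(4) into two copies of so(3), the
orbit is the product of the spheres of radii \<open>\<bar>p + q\<bar>\<close> and \<open>\<bar>p - q\<bar>\<close>, so a curve in it is a pair
of curves on spheres.\<close>

lemma curve_in_orb_exists:
  assumes M: "M1 p q \<in> orb c1 c2" and pq: "q\<^sup>2 < p\<^sup>2" and v: "v \<in> orb_tangent (M1 p q)"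
  obtains \<gamma> where "(\<gamma> has_vector_derivative v) (at 0)" "\<gamma> 0 = M1 p q" "\<And>t. \<gamma> t \<in> orb c1 c2"
proof -
  obtain a b c d where v: "v = tangent_vector a b c d"
    using v unfolding orb_tangent_M1[OF pq] by auto
  have "(p + q) * (p - q) \<noteq> 0" using pq by (simp add: power2_eq_square algebra_simps)
  then have nz: "p + q \<noteq> 0" "p - q \<noteq> 0" by auto
  define z where "z = sphere_curve (p + q) (a + c) (b + d)"
  define w where "w = sphere_curve (p - q) (a - c) (b - d)"
  have zz: "z t \<bullet> z t = (p + q)\<^sup>2" and ww: "w t \<bullet> w t = (p - q)\<^sup>2" for t
    using nz by (simp_all add: z_def w_def sphere_curve_norm)
  define \<gamma> where "\<gamma> t = so4_matrix ((1/2) *\<^sub>R (z t + w t)) ((1/2) *\<^sub>R (z t - w t))" for t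
  show thesis
  proof
    show "(\<gamma> has_vector_derivative v) (at 0)"
      unfolding \<gamma>_def v tangent_vector_def
    proof (rule has_vector_derivative_so4_matrix)
      note D = sphere_curve_derivative[of "p + q" "a + c" "b + d"] sphere_curve_derivative[of "p - q" "a - c" "b - d"]
      show "((\<lambda>t. ((1/2) *\<^sub>R (z t + w t)) $ i) has_real_derivative vector [0, a, b] $ i) (at 0)" for i
        using exhaust_3[of i] unfolding z_def w_def
        by (auto intro!: derivative_eq_intros D)
      show "((\<lambda>t. ((1/2) *\<^sub>R (z t - w t)) $ i) has_real_derivative vector [0, c, d] $ i) (at 0)" for i
        using exhaust_3[of i] unfolding z_def w_def
        by (auto intro!: derivative_eq_intros D)
    qed
    show "\<gamma> 0 = M1 p q"
      by (simp add: \<gamma>_def z_def w_def sphere_curve_0 M1_def vec_3_eq_iff)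
    show "\<gamma> t \<in> orb c1 c2" for t
    proof -
      have "casimir1 (\<gamma> t) = (z t \<bullet> z t + w t \<bullet> w t) / 4"
        by (simp add: \<gamma>_def casimir1_so4_matrix inner_simps inner_commute) (simp add: field_simps)
      moreover have "casimir2 (\<gamma> t) = (z t \<bullet> z t - w t \<bullet> w t) / 4"
        by (simp add: \<gamma>_def casimir2_so4_matrix inner_simps inner_commute)
      ultimately show ?thesis
        using M unfolding M1_in_orb_iff zz ww
        by (simp add: orb_def \<gamma>_def) (simp add: power2_eq_square field_simps)
    qed
  qed
qed

text \<open>The derivative on the orbit is defined by a choice among the derivatives within the orbit. All
of them agree on tangent vectors, since every tangent vector is the velocity of a curve in the
orbit.\<close>

lemma orb_derivative_M1:
  assumes M: "M1 p q \<in> orb c1 c2" and pq: "q\<^sup>2 < p\<^sup>2"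
    and D: "(f has_derivative D) (at (M1 p q) within orb c1 c2)"
  shows "orb_derivative f c1 c2 (M1 p q) = restrict D (orb_tangent (M1 p q))"
  unfolding orb_derivative_def
proof (rule restrict_ext)
  fix v assume "v \<in> orb_tangent (M1 p q)"
  then obtain \<gamma> where "(\<gamma> has_vector_derivative v) (at 0)" "\<gamma> 0 = M1 p q" "\<And>t. \<gamma> t \<in> orb c1 c2"
    using curve_in_orb_exists[OF M pq] by metis
  moreover have "(f has_derivative frechet_derivative f (at (M1 p q) within orb c1 c2))
      (at (M1 p q) within orb c1 c2)"
    using D frechet_derivative_works by (auto simp: differentiable_def)
  ultimately show "frechet_derivative f (at (M1 p q) within orb c1 c2) v = D v"
    using has_derivative_within_unique_along_curve[OF _ D] by blast
qed

lemma orb_subset_so4: "orb c1 c2 \<subseteq> so4"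
  by (auto simp: orb_def)

lemma diagonal_field_has_derivative:
  "(diagonal_field f has_derivative
     (\<lambda>u. lie_bracket M (diagonal_operator f u) + lie_bracket u (diagonal_operator f M))) (at M within S)"
  unfolding diagonal_field_def [abs_def]
  by (intro bounded_bilinear.FDERIV[OF bounded_bilinear_lie_bracket] has_derivative_ident
      bounded_linear_imp_has_derivative bounded_linear_diagonal_operator)

lemma diagonal_operator_M1: "diagonal_operator f (M1 p q) = M1 (f 2 3 * p) (f 1 4 * q)"
  by (simp add: diagonal_operator_def M1_def)

lemma lie_bracket_M1_M1: "lie_bracket (M1 p q) (M1 p' q') = 0"
  by (subst (2) M1_def) (simp add: M1_bracket tangent_vector_linear)

lemma diagonal_field_M1: "diagonal_field f (M1 p q) = 0"
  by (simp add: diagonal_field_def diagonal_operator_M1 lie_bracket_M1_M1)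

text \<open>The values of the Casimirs are those of \<open>M1 p q\<close>, so that this is the linearization on the
orbit through that point.\<close>

definition linearized_field :: "real \<Rightarrow> real \<Rightarrow> (4 \<Rightarrow> 4 \<Rightarrow> real) \<Rightarrow> real^4^4 \<Rightarrow> real^4^4" where
  "linearized_field p q f =
     orb_derivative (hamiltonian_field (diagonal_form f)) ((p\<^sup>2 + q\<^sup>2) / 2) (p * q) (M1 p q)"

lemma linearized_field_tangent_vector:
  assumes pq: "q\<^sup>2 < p\<^sup>2"
  shows "linearized_field p q f (tangent_vector a b c d) = tangent_vector
    (p * (f 2 3 - f 1 2) * b + q * (f 1 4 - f 3 4) * d)
    (- p * (f 2 3 - f 1 3) * a - q * (f 1 4 - f 2 4) * c)
    (q * (f 1 4 - f 1 2) * b + p * (f 2 3 - f 3 4) * d)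
    (- q * (f 1 4 - f 1 3) * a - p * (f 2 3 - f 2 4) * c)"
proof -
  let ?c1 = "(p\<^sup>2 + q\<^sup>2) / 2" and ?c2 = "p * q"
  have M: "M1 p q \<in> orb ?c1 ?c2" by (simp add: M1_in_orb_iff)
  have "(hamiltonian_field (diagonal_form f) has_derivative
     (\<lambda>u. lie_bracket (M1 p q) (diagonal_operator f u) + lie_bracket u (diagonal_operator f (M1 p q))))
     (at (M1 p q) within orb ?c1 ?c2)"
    using M orb_subset_so4
    by (intro has_derivative_transform[OF _ _ diagonal_field_has_derivative])
      (auto intro!: hamiltonian_field_diagonal_form)
  from orb_derivative_M1[OF M pq this]
  have "linearized_field p q f (tangent_vector a b c d) =
    lie_bracket (M1 p q) (diagonal_operator f (tangent_vector a b c d))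
    + lie_bracket (tangent_vector a b c d) (diagonal_operator f (M1 p q))"
    unfolding linearized_field_def orb_tangent_M1[OF pq] by auto
  also have "lie_bracket (tangent_vector a b c d) (diagonal_operator f (M1 p q)) =
      - lie_bracket (M1 (f 2 3 * p) (f 1 4 * q)) (tangent_vector a b c d)"
    by (simp add: diagonal_operator_M1 lie_bracket_def)
  finally show ?thesis
    unfolding tangent_vector_def diagonal_operator_def x_coords_so4_matrix y_coords_so4_matrix M1_bracket
    by (simp add: so4_matrix_add so4_matrix_diff tangent_vector_def vec_3_eq_iff algebra_simps)
qed

lemma linearized_field_extensional: "linearized_field p q f \<in> extensional (orb_tangent (M1 p q))"
  by (simp add: linearized_field_def orb_derivative_def)

lemma orb_derivative_diagonal_form_M1:
  assumes pq: "q\<^sup>2 < p\<^sup>2" and M: "M1 p q \<in> orb c1 c2" and v: "v \<in> orb_tangent (M1 p q)"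
  shows "orb_derivative (diagonal_form f) c1 c2 (M1 p q) v = 0"
proof -
  have "(diagonal_form f has_derivative so4_inner (diagonal_operator f (M1 p q))) (at (M1 p q) within orb c1 c2)"
    using diagonal_form_has_derivative[OF M1_in_so4] orb_subset_so4 by (rule has_derivative_subset)
  from orb_derivative_M1[OF M pq this] v show ?thesis
    unfolding orb_tangent_M1[OF pq] diagonal_operator_M1
    by (auto simp: M1_def tangent_vector_def so4_inner_so4_matrix inner_vec_def sum_3)
qed

section \<open>The Cartan subalgebra of center-center matrices\<close>

definition center_center_matrix :: "real \<Rightarrow> real \<Rightarrow> real^4^4" where
  "center_center_matrix A B = vector [
     vector [0, 0, -A, 0], vector [0, 0, 0, -B], vector [A, 0, 0, 0], vector [0, B, 0, 0]]"

lemma center_center_matrices_eq: "center_center_matrices = {center_center_matrix A B | A B. True}"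
  by (simp add: center_center_matrices_def center_center_matrix_def)

lemma center_center_matrix_nth [simp]:
  "center_center_matrix A B $ 1 $ 1 = 0" "center_center_matrix A B $ 1 $ 2 = 0"
  "center_center_matrix A B $ 1 $ 3 = - A" "center_center_matrix A B $ 1 $ 4 = 0"
  "center_center_matrix A B $ 2 $ 1 = 0" "center_center_matrix A B $ 2 $ 2 = 0"
  "center_center_matrix A B $ 2 $ 3 = 0" "center_center_matrix A B $ 2 $ 4 = - B"
  "center_center_matrix A B $ 3 $ 1 = A" "center_center_matrix A B $ 3 $ 2 = 0"
  "center_center_matrix A B $ 3 $ 3 = 0" "center_center_matrix A B $ 3 $ 4 = 0"
  "center_center_matrix A B $ 4 $ 1 = 0" "center_center_matrix A B $ 4 $ 2 = B"
  "center_center_matrix A B $ 4 $ 3 = 0" "center_center_matrix A B $ 4 $ 4 = 0"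
  unfolding center_center_matrix_def vector_4_nth by (rule refl)+

lemma center_center_matrix_add:
    "center_center_matrix A B + center_center_matrix A' B' = center_center_matrix (A + A') (B + B')"
  and center_center_matrix_scale: "r *\<^sub>R center_center_matrix A B = center_center_matrix (r * A) (r * B)"
  and center_center_matrix_zero: "center_center_matrix 0 0 = 0"
  and center_center_matrix_commute:
    "center_center_matrix A B ** center_center_matrix A' B' - center_center_matrix A' B' ** center_center_matrix A B = 0"
  unfolding matrix_4_eq_iff by (simp_all add: matrix_matrix_mult_def sum_4)

lemma canonical_form_center_center_matrix:
  "canonical_form (center_center_matrix A B *v x) y + canonical_form x (center_center_matrix A B *v y) = 0"
  by (simp add: canonical_form_def matrix_vector_mult_def sum_4)

text \<open>Let \<open>J\<^sub>1\<close> and \<open>J\<^sub>2\<close> be the center-center matrices for \<open>(A, B) = (1, 0)\<close> and \<open>(0, 1)\<close>. Comparing the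
entries of \<open>[N, J\<^sub>1]\<close> and \<open>[N, J\<^sub>2]\<close> with those of center-center matrices shows that both brackets
vanish. The matrices that commute with both are block matrices \<open>a + b J\<close> on each of
the two planes, and infinitesimal symplecticity removes the scalar part \<open>a\<close>.\<close>

lemma center_center_normalizer:
  assumes bracket: "\<And>C. C \<in> center_center_matrices \<Longrightarrow> N ** C - C ** N \<in> center_center_matrices"
    and symplectic: "\<And>x y. canonical_form (N *v x) y + canonical_form x (N *v y) = 0"
  shows "N \<in> center_center_matrices"
proof -
  have "N ** center_center_matrix A B - center_center_matrix A B ** N \<in> center_center_matrices" for A B
    by (rule bracket) (auto simp: center_center_matrices_eq)
  then have "\<exists>A' B'. N ** center_center_matrix A B - center_center_matrix A B ** N = center_center_matrix A' B'" for A B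
    by (simp add: center_center_matrices_eq)
  then obtain A B A' B' where
    1: "N ** center_center_matrix 1 0 - center_center_matrix 1 0 ** N = center_center_matrix A B" and
    2: "N ** center_center_matrix 0 1 - center_center_matrix 0 1 ** N = center_center_matrix A' B'"
    by metis
  note e1 = 1[unfolded matrix_4_eq_iff, simplified matrix_matrix_mult_def sum_4 vec_lambda_beta
      vector_minus_component center_center_matrix_nth, simplified]
  note e2 = 2[unfolded matrix_4_eq_iff, simplified matrix_matrix_mult_def sum_4 vec_lambda_beta
      vector_minus_component center_center_matrix_nth, simplified]
  have s: "N $ 1 $ 1 = - N $ 3 $ 3" "N $ 2 $ 2 = - N $ 4 $ 4"
    using symplectic[of "axis 1 1" "axis 3 1"] symplectic[of "axis 2 1" "axis 4 1"]
    by (simp_all add: canonical_form_def matrix_vector_mult_def sum_4 axis_def)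
  have "N = center_center_matrix (N $ 3 $ 1) (N $ 4 $ 2)"
    unfolding matrix_4_eq_iff center_center_matrix_nth
    using e1 e2 s by (auto simp: algebra_simps)
  then show ?thesis by (auto simp: center_center_matrices_eq)
qed

text \<open>A linear symplectic isomorphism \<open>\<phi>\<close> from a symplectic vector space \<open>T\<close> to the standard one
transports statements about operators on \<open>T\<close> to statements about matrices.\<close>

locale symplectic_chart =
  fixes T :: "'a::real_vector set" and w :: "'a \<Rightarrow> 'a \<Rightarrow> real" and \<phi> :: "'a \<Rightarrow> real^4"
  assumes subspace: "subspace T" and linear: "linear \<phi>" and bij: "bij_betw \<phi> T UNIV"
    and symplectic: "\<And>u v. u \<in> T \<Longrightarrow> v \<in> T \<Longrightarrow> canonical_form (\<phi> u) (\<phi> v) = w u v"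
begin

definition pull :: "real^4^4 \<Rightarrow> 'a \<Rightarrow> 'a" where
  "pull N = (\<lambda>v\<in>T. inv_into T \<phi> (N *v \<phi> v))"

lemma chart_inj: "u \<in> T \<Longrightarrow> v \<in> T \<Longrightarrow> \<phi> u = \<phi> v \<longleftrightarrow> u = v"
  using bij by (meson bij_betw_def inj_on_eq_iff)

lemma inv_chart: "inv_into T \<phi> z \<in> T" "\<phi> (inv_into T \<phi> z) = z"
  using bij by (auto simp: bij_betw_def inv_into_into f_inv_into_f)

lemma pull_in: "v \<in> T \<Longrightarrow> pull N v \<in> T"
  and chart_pull: "v \<in> T \<Longrightarrow> \<phi> (pull N v) = N *v \<phi> v"
  by (simp_all add: pull_def inv_chart)

lemma T_comb: "u \<in> T \<Longrightarrow> v \<in> T \<Longrightarrow> r *\<^sub>R u + s *\<^sub>R v \<in> T"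
  using subspace by (simp add: subspace_add subspace_mul)

lemma chart_comb: "\<phi> (r *\<^sub>R u + s *\<^sub>R v) = r *\<^sub>R \<phi> u + s *\<^sub>R \<phi> v"
  by (simp add: linear_add[OF linear] linear_scale[OF linear])

lemma pull_eqI:
  assumes "A \<in> T \<rightarrow>\<^sub>E T" "\<And>v. v \<in> T \<Longrightarrow> \<phi> (A v) = N *v \<phi> v"
  shows "A = pull N"
proof (rule extensionalityI)
  show "A \<in> extensional T" using assms(1) by (simp add: PiE_def)
  show "pull N \<in> extensional T" by (simp add: pull_def)
  show "A v = pull N v" if "v \<in> T" for v
    using that assms by (intro chart_inj[THEN iffD1]) (auto simp: chart_pull pull_in)
qed

lemma pull_in_operators: "pull N \<in> operators T"
proof -
  have "pull N (r *\<^sub>R u + s *\<^sub>R v) = r *\<^sub>R pull N u + s *\<^sub>R pull N v" if "u \<in> T" "v \<in> T" for u v r s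
  proof (rule chart_inj[THEN iffD1])
    show "\<phi> (pull N (r *\<^sub>R u + s *\<^sub>R v)) = \<phi> (r *\<^sub>R pull N u + s *\<^sub>R pull N v)"
      using that by (simp add: chart_pull T_comb chart_comb matrix_vector_right_distrib
          matrix_vector_mult_scaleR)
  qed (use that in \<open>simp_all add: pull_in T_comb\<close>)
  then show ?thesis
    by (auto simp: operators_def pull_in) (simp add: pull_def)
qed

text \<open>Together with \<open>pull_inj\<close> this identifies the operators on \<open>T\<close> with all the matrices, so that the
normalizer of a set of operators can be computed with matrices.\<close>

lemma operator_eq_pull:
  assumes A: "A \<in> operators T"
  obtains N where "A = pull N"
proof -
  define g where "g z = \<phi> (A (inv_into T \<phi> z))" for z
  have AT: "A \<in> T \<rightarrow>\<^sub>E T" and A_lin: "\<And>u v r s. u \<in> T \<Longrightarrow> v \<in> T \<Longrightarrow> A (r *\<^sub>R u + s *\<^sub>R v) = r *\<^sub>R A u + s *\<^sub>R A v"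
    using A by (auto simp: operators_def)
  have g_comb: "g (r *\<^sub>R y + s *\<^sub>R z) = r *\<^sub>R g y + s *\<^sub>R g z" for r s y z
  proof -
    have "inv_into T \<phi> (r *\<^sub>R y + s *\<^sub>R z) = r *\<^sub>R inv_into T \<phi> y + s *\<^sub>R inv_into T \<phi> z"
      by (rule chart_inj[THEN iffD1]) (simp_all add: inv_chart chart_comb T_comb)
    then show ?thesis by (simp add: g_def A_lin inv_chart chart_comb)
  qed
  have "linear g"
    using g_comb[of 1 _ 1] g_comb[of _ _ 0] by (intro linearI) simp_all
  then have "matrix g *v \<phi> v = \<phi> (A v)" if "v \<in> T" for v
    using that bij by (simp add: matrix_works g_def bij_betw_def)
  then have "A = pull (matrix g)"
    using AT by (intro pull_eqI) simp_all
  then show thesis by (rule that)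
qed

lemma pull_inj: "pull N = pull N' \<longleftrightarrow> N = N'"
proof
  assume "pull N = pull N'"
  then have "N *v z = N' *v z" for z
    by (metis chart_pull inv_chart)
  then show "N = N'" by (simp add: matrix_eq)
qed simp

lemma pull_zero: "op_zero T = pull 0"
  by (rule pull_eqI) (auto simp: op_zero_def subspace_0[OF subspace] linear_0[OF linear])

lemma pull_add: "op_add T (pull N) (pull N') = pull (N + N')"
  by (rule pull_eqI)
    (auto simp: op_add_def pull_in subspace_add[OF subspace] linear_add[OF linear] chart_pull
      matrix_vector_mult_add_rdistrib)

lemma pull_scale: "op_scale T r (pull N) = pull (r *\<^sub>R N)"
  by (rule pull_eqI)
    (auto simp: op_scale_def pull_in subspace_mul[OF subspace] linear_scale[OF linear] chart_pull
      scaleR_matrix_vector_assoc)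

lemma pull_bracket: "op_bracket T (pull N) (pull N') = pull (N ** N' - N' ** N)"
  by (rule pull_eqI)
    (auto simp: op_bracket_def pull_in subspace_diff[OF subspace] linear_diff[OF linear] chart_pull
      matrix_vector_mul_assoc matrix_vector_mult_diff_rdistrib)

lemma pull_inf_symplectic_iff:
  "pull N \<in> inf_symplectic T w \<longleftrightarrow> (\<forall>x y. canonical_form (N *v x) y + canonical_form x (N *v y) = 0)"
proof -
  have "w (pull N u) v + w u (pull N v) = canonical_form (N *v \<phi> u) (\<phi> v) + canonical_form (\<phi> u) (N *v \<phi> v)"
    if "u \<in> T" "v \<in> T" for u v
    using that by (simp add: symplectic[symmetric] pull_in chart_pull)
  then show ?thesis
    unfolding inf_symplectic_def mem_Collect_eq
    by (metis (no_types, lifting) inv_chart pull_in_operators)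
qed

lemma center_center_subspace: "op_subspace T (pull ` center_center_matrices)"
  unfolding op_subspace_def center_center_matrices_eq
proof (intro conjI ballI allI)
  show "op_zero T \<in> pull ` {center_center_matrix A B | A B. True}"
    unfolding pull_zero center_center_matrix_zero[symmetric] by blast
qed (auto intro!: imageI simp: pull_in_operators pull_add pull_scale center_center_matrix_add
    center_center_matrix_scale, blast+)

lemma center_center_bracket:
  "A \<in> pull ` center_center_matrices \<Longrightarrow> B \<in> pull ` center_center_matrices \<Longrightarrow> op_bracket T A B = op_zero T"
  by (auto simp: center_center_matrices_eq pull_bracket center_center_matrix_commute pull_zero)

lemma center_center_lie_algebra: "lie_algebra_of_ops T (pull ` center_center_matrices)"
  using center_center_subspace
  by (auto simp: lie_algebra_of_ops_def center_center_bracket op_subspace_def)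

lemma op_span_zero: "op_span T {op_zero T} = {op_zero T}"
proof -
  have "op_subspace T {op_zero T}"
    by (auto simp: op_subspace_def pull_zero pull_in_operators pull_add pull_scale)
  then show ?thesis by (auto simp: op_span_def op_subspace_def)
qed

lemma center_center_nilpotent: "lie_nilpotent T (pull ` center_center_matrices)"
proof -
  let ?K = "pull ` center_center_matrices"
  have "op_zero T \<in> ?K" using center_center_subspace by (simp add: op_subspace_def)
  moreover have "op_bracket T A B = op_zero T" if "A \<in> ?K" "B \<in> ?K" for A B
    using that by (rule center_center_bracket)
  ultimately have "{op_bracket T A B | A B. A \<in> ?K \<and> B \<in> ?K} = {op_zero T}"
    by (intro set_eqI) (simp, metis)
  then have "lower_central T ?K 1 = {op_zero T}"
    by (simp add: op_span_zero)
  then show ?thesis unfolding lie_nilpotent_def by blast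
qed

lemma center_center_cartan:
  "cartan_subalgebra T (inf_symplectic T w) (pull ` center_center_matrices)"
proof -
  let ?K = "pull ` center_center_matrices"
  have sub: "?K \<subseteq> inf_symplectic T w"
    by (auto simp: center_center_matrices_eq pull_inf_symplectic_iff canonical_form_center_center_matrix)
  have "A \<in> ?K" if A: "A \<in> inf_symplectic T w" and norm: "\<forall>B\<in>?K. op_bracket T A B \<in> ?K" for A
  proof -
    obtain N where N: "A = pull N"
      using A operator_eq_pull by (auto simp: inf_symplectic_def)
    have "N ** C - C ** N \<in> center_center_matrices" if "C \<in> center_center_matrices" for C
      using norm that unfolding N by (auto simp: pull_bracket image_iff pull_inj)
    moreover have "canonical_form (N *v x) y + canonical_form x (N *v y) = 0" for x y
      using A unfolding N pull_inf_symplectic_iff by blast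
    ultimately have "N \<in> center_center_matrices"
      by (rule center_center_normalizer)
    then show ?thesis using N by blast
  qed
  moreover have "\<forall>B\<in>?K. op_bracket T A B \<in> ?K" if "A \<in> ?K" for A
    using that center_center_lie_algebra unfolding lie_algebra_of_ops_def by blast
  ultimately have "{A \<in> inf_symplectic T w. \<forall>B\<in>?K. op_bracket T A B \<in> ?K} = ?K"
    using sub by blast
  then show ?thesis
    using sub center_center_lie_algebra center_center_nilpotent by (simp add: cartan_subalgebra_def)
qed

text \<open>A Lie algebra is closed under linear combinations, and two center-center matrices with linearly
independent parameters span all of them by Cramer's rule. The span is already a Lie
algebra because its members commute.\<close>

lemma center_center_generated:
  assumes det: "a * b' - a' * b \<noteq> 0"
  shows "lie_generated T {pull (center_center_matrix a b), pull (center_center_matrix a' b')}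
    = pull ` center_center_matrices"
proof
  let ?S = "{pull (center_center_matrix a b), pull (center_center_matrix a' b')}"
  show "lie_generated T ?S \<subseteq> pull ` center_center_matrices"
    using center_center_lie_algebra unfolding lie_generated_def center_center_matrices_eq by blast
  show "pull ` center_center_matrices \<subseteq> lie_generated T ?S"
    unfolding lie_generated_def
  proof (intro Inter_greatest subsetI, clarify)
    fix L C assume L: "lie_algebra_of_ops T L" "?S \<subseteq> L" and "C \<in> center_center_matrices"
    then obtain A B where C: "C = center_center_matrix A B"
      by (auto simp: center_center_matrices_eq)
    let ?d = "a * b' - a' * b"
    let ?r = "(A * b' - a' * B) / ?d" and ?s = "(a * B - A * b) / ?d"
    have "?r * a + ?s * a' = A" "?r * b + ?s * b' = B"
    proof -
      have "(A * b' - a' * B) * a + (a * B - A * b) * a' = A * ?d"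
        "(A * b' - a' * B) * b + (a * B - A * b) * b' = B * ?d"
        by algebra+
      then show "?r * a + ?s * a' = A" "?r * b + ?s * b' = B"
        using det by (simp_all add: add_divide_distrib[symmetric] nonzero_divide_eq_eq)
    qed
    then have "pull C = op_add T (op_scale T ?r (pull (center_center_matrix a b)))
        (op_scale T ?s (pull (center_center_matrix a' b')))"
      by (simp add: C pull_add pull_scale center_center_matrix_add center_center_matrix_scale)
    then show "pull C \<in> L"
      using L by (simp add: lie_algebra_of_ops_def op_subspace_def)
  qed
qed

lemma center_center_conjugate:
  "{N. \<exists>A\<in>pull ` center_center_matrices. \<forall>v\<in>T. \<phi> (A v) = N *v \<phi> v} = center_center_matrices"
proof -
  have "N = C" if "\<And>v. v \<in> T \<Longrightarrow> \<phi> (pull C v) = N *v \<phi> v" for N C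
    using that by (metis chart_pull inv_chart matrix_eq)
  then show ?thesis by (auto simp: chart_pull) 
qed

end

section \<open>Normal modes\<close>

text \<open>With \<open>s\<^sub>k\<^sup>2 = t - \<lambda>\<^sub>k\<^sup>2\<close> these are the weights of the integral \<open>F\<^sub>t\<close>.\<close>

definition mode_weight :: "real^4 \<Rightarrow> 4 \<Rightarrow> 4 \<Rightarrow> real" where
  "mode_weight s i j = (\<Prod>k\<in>-{i, j}. (s$k)\<^sup>2)"

lemma mode_weight_simps [simp]:
  "mode_weight s 2 3 = (s$1 * s$4)\<^sup>2" "mode_weight s 1 4 = (s$2 * s$3)\<^sup>2"
  "mode_weight s 1 3 = (s$2 * s$4)\<^sup>2" "mode_weight s 2 4 = (s$1 * s$3)\<^sup>2"
  "mode_weight s 1 2 = (s$3 * s$4)\<^sup>2" "mode_weight s 3 4 = (s$1 * s$2)\<^sup>2"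
proof -
  have "-{2, 3} = {1, 4::4}" "-{1, 4} = {2, 3::4}" "-{1, 3} = {2, 4::4}" "-{2, 4} = {1, 3::4}"
    "-{1, 2} = {3, 4::4}" "-{3, 4} = {1, 2::4}"
    unfolding Compl_eq_Diff_UNIV UNIV_4 by auto
  then show "mode_weight s 2 3 = (s$1 * s$4)\<^sup>2" "mode_weight s 1 4 = (s$2 * s$3)\<^sup>2"
  "mode_weight s 1 3 = (s$2 * s$4)\<^sup>2" "mode_weight s 2 4 = (s$1 * s$3)\<^sup>2"
  "mode_weight s 1 2 = (s$3 * s$4)\<^sup>2" "mode_weight s 3 4 = (s$1 * s$2)\<^sup>2"
    by (simp_all add: mode_weight_def power_mult_distrib)
qed

text \<open>The two linear functions whose squares, together with the square of
\<open>s\<^sub>1 s\<^sub>4 x\<^sub>1 - s\<^sub>2 s\<^sub>3 y\<^sub>1\<close>, add up to \<open>2 F\<^sub>t\<close> minus a multiple of \<open>C\<^sub>2\<close>, where \<open>F\<^sub>t\<close> is the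
diagonal form of the weights above.\<close>

definition mode_xi :: "real^4 \<Rightarrow> real^4^4 \<Rightarrow> real" where
  "mode_xi s M = s$2 * s$4 * x_coords M $ 2 - s$1 * s$3 * y_coords M $ 2"

definition mode_eta :: "real^4 \<Rightarrow> real^4^4 \<Rightarrow> real" where
  "mode_eta s M = s$3 * s$4 * x_coords M $ 3 - s$1 * s$2 * y_coords M $ 3"

lemma mode_xi_tangent [simp]:
    "mode_xi s (tangent_vector a b c e) = s$2 * s$4 * a - s$1 * s$3 * c"
  and mode_eta_tangent [simp]:
    "mode_eta s (tangent_vector a b c e) = s$3 * s$4 * b - s$1 * s$2 * e"
  by (simp_all add: mode_xi_def mode_eta_def tangent_vector_def)

lemma linear_mode_xi: "linear (mode_xi s)" and linear_mode_eta: "linear (mode_eta s)"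
  by (auto intro!: linearI simp: mode_xi_def mode_eta_def
      linear_add[OF linear_x_coords] linear_add[OF linear_y_coords]
      linear_scale[OF linear_x_coords] linear_scale[OF linear_y_coords] algebra_simps)

lemmas mode_linear =
  linear_add[OF linear_mode_xi] linear_add[OF linear_mode_eta]
  linear_diff[OF linear_mode_xi] linear_diff[OF linear_mode_eta]
  linear_neg[OF linear_mode_xi] linear_neg[OF linear_mode_eta]
  linear_scale[OF linear_mode_xi] linear_scale[OF linear_mode_eta]

text \<open>The values at \<open>M1 p q\<close> of the Hamiltonian fields of the linear functions \<^const>\<open>mode_xi\<close> and
\<^const>\<open>mode_eta\<close>, that is, the brackets of \<open>M1 p q\<close> with their gradients.\<close>

definition xi_flow :: "real \<Rightarrow> real \<Rightarrow> real^4 \<Rightarrow> real^4^4" where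
  "xi_flow p q s = tangent_vector 0 (p * s$2 * s$4 - q * s$1 * s$3) 0 (q * s$2 * s$4 - p * s$1 * s$3)"

definition eta_flow :: "real \<Rightarrow> real \<Rightarrow> real^4 \<Rightarrow> real^4^4" where
  "eta_flow p q s = tangent_vector (q * s$1 * s$2 - p * s$3 * s$4) 0 (p * s$1 * s$2 - q * s$3 * s$4) 0"

text \<open>Modulo Casimirs the Hamiltonian is \<open>(\<xi>\<^sup>2 + \<eta>\<^sup>2) / 2\<close> on the tangent space, so its linearized
field is \<open>\<xi>\<close> times the Hamiltonian vector of \<open>\<xi>\<close> plus \<open>\<eta>\<close> times that of \<open>\<eta>\<close>. The square of
\<open>s\<^sub>1 s\<^sub>4 x\<^sub>1 - s\<^sub>2 s\<^sub>3 y\<^sub>1\<close> contributes nothing, since this function vanishes on tangent vectors and, by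
the relation \<open>p s\<^sub>1 s\<^sub>4 = q s\<^sub>2 s\<^sub>3\<close>, at the equilibrium.\<close>

lemma linearized_field_mode_weight:
  assumes pq: "q\<^sup>2 < p\<^sup>2" and node: "p * s$1 * s$4 = q * s$2 * s$3" and v: "v \<in> orb_tangent (M1 p q)"
  shows "linearized_field p q (mode_weight s) v = mode_xi s v *\<^sub>R xi_flow p q s + mode_eta s v *\<^sub>R eta_flow p q s"
proof -
  obtain a b c e where v: "v = tangent_vector a b c e"
    using v unfolding orb_tangent_M1[OF pq] by auto
  show ?thesis
    unfolding v linearized_field_tangent_vector[OF pq] xi_flow_def eta_flow_def
      tangent_vector_linear tangent_vector_eq_iff mode_weight_simps mode_xi_tangent mode_eta_tangent
    using node by (intro conjI) algebra+
qed

text \<open>Adding a constant to all weights adds a multiple of \<open>C\<^sub>1\<close> to the form and does not change the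
field.\<close>

lemma linearized_field_linear:
  assumes pq: "q\<^sup>2 < p\<^sup>2" and v: "v \<in> orb_tangent (M1 p q)"
    and f: "\<And>i j. i \<noteq> j \<Longrightarrow> f i j = \<alpha> * g i j + \<beta> * h i j + \<gamma>"
  shows "linearized_field p q f v = \<alpha> *\<^sub>R linearized_field p q g v + \<beta> *\<^sub>R linearized_field p q h v"
proof -
  obtain a b c e where v: "v = tangent_vector a b c e"
    using v unfolding orb_tangent_M1[OF pq] by auto
  show ?thesis
    unfolding v linearized_field_tangent_vector[OF pq] tangent_vector_linear tangent_vector_eq_iff
    by (simp add: f algebra_simps)
qed

text \<open>This is the Poisson bracket of \<open>\<xi>\<close> and \<open>\<eta>\<close>, up to sign; its modulus is the frequency of the
oscillation that the Hamiltonian \<open>(\<xi>\<^sup>2 + \<eta>\<^sup>2) / 2\<close> generates.\<close>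

definition mode_frequency :: "real \<Rightarrow> real \<Rightarrow> real \<Rightarrow> real^4 \<Rightarrow> real" where
  "mode_frequency p q d s = s$2 * s$3 * d * (p\<^sup>2 - q\<^sup>2) / p"

text \<open>Here \<open>s\<^sub>i\<^sup>2 = t - \<lambda>\<^sub>i\<^sup>2\<close> and \<open>r\<^sub>i\<^sup>2 = \<lambda>\<^sub>i\<^sup>2 - t'\<close>, so that the sum of the two is \<open>d = t - t'\<close>
for every \<open>i\<close>. The assumptions are symmetric in \<open>s\<close> and \<open>r\<close>, so that every
fact about one mode holds for the other.\<close>

locale normal_modes =
  fixes p q d :: real and s r :: "real^4"
  assumes pq: "q\<^sup>2 < p\<^sup>2" and d: "d > 0"
    and sum: "\<And>i. (s$i)\<^sup>2 + (r$i)\<^sup>2 = d"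
    and node_s: "p * s$1 * s$4 = q * s$2 * s$3" and node_r: "p * r$1 * r$4 = q * r$2 * r$3"
    and nonzero: "s$2 \<noteq> 0" "s$3 \<noteq> 0" "r$2 \<noteq> 0" "r$3 \<noteq> 0"
begin

lemma swap: "normal_modes p q d r s"
  using pq d sum node_s node_r nonzero by unfold_locales (auto simp: add.commute)

lemma p_nz: "p \<noteq> 0"
  using pq by auto

lemma r_square: "(r$i)\<^sup>2 = d - (s$i)\<^sup>2"
  using sum[of i] by simp

lemma node_squares: "p\<^sup>2 * ((s$1)\<^sup>2 * (s$4)\<^sup>2) = q\<^sup>2 * ((s$2)\<^sup>2 * (s$3)\<^sup>2)"
  using node_s by algebra

text \<open>The parameters \<open>t\<close> and \<open>t'\<close> are the two roots of one quadratic polynomial. Eliminating \<open>r\<close> from the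
relation for \<open>t'\<close> and dividing by \<open>d\<close> leaves Vieta's formula for the sum of the roots.\<close>

lemma node_sum: "p\<^sup>2 * (d - (s$1)\<^sup>2 - (s$4)\<^sup>2) = q\<^sup>2 * (d - (s$2)\<^sup>2 - (s$3)\<^sup>2)"
proof -
  have "p\<^sup>2 * ((r$1)\<^sup>2 * (r$4)\<^sup>2) = q\<^sup>2 * ((r$2)\<^sup>2 * (r$3)\<^sup>2)"
    using node_r by algebra
  then have "d * (p\<^sup>2 * (d - (s$1)\<^sup>2 - (s$4)\<^sup>2)) = d * (q\<^sup>2 * (d - (s$2)\<^sup>2 - (s$3)\<^sup>2))"
    unfolding r_square using node_squares by algebra
  then show ?thesis using d by simp
qed

lemma xi_eta_flow: "mode_xi s (eta_flow p q s) = - mode_frequency p q d s"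
  and eta_xi_flow: "mode_eta s (xi_flow p q s) = mode_frequency p q d s"
proof -
  have "p * (p * (s$2 * s$3) * ((s$1)\<^sup>2 + (s$4)\<^sup>2) - q * s$1 * s$4 * ((s$2)\<^sup>2 + (s$3)\<^sup>2)) =
      s$2 * s$3 * (p\<^sup>2 * ((s$1)\<^sup>2 + (s$4)\<^sup>2) - q\<^sup>2 * ((s$2)\<^sup>2 + (s$3)\<^sup>2))"
    using node_s by algebra
  also have "\<dots> = s$2 * s$3 * d * (p\<^sup>2 - q\<^sup>2)"
    using node_sum by algebra
  finally have *: "p * (s$2 * s$3) * ((s$1)\<^sup>2 + (s$4)\<^sup>2) - q * s$1 * s$4 * ((s$2)\<^sup>2 + (s$3)\<^sup>2) =
      mode_frequency p q d s"
    using p_nz by (simp add: mode_frequency_def field_simps)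
  show "mode_xi s (eta_flow p q s) = - mode_frequency p q d s"
    "mode_eta s (xi_flow p q s) = mode_frequency p q d s"
    unfolding *[symmetric] eta_flow_def xi_flow_def by (simp_all, algebra+)
qed

text \<open>The functions \<open>\<xi>\<close> and \<open>\<eta>\<close> of different modes Poisson commute. If \<open>q \<noteq> 0\<close>, then multiplication
by \<open>r\<^sub>1 s\<^sub>4 p\<^sup>2 \<noteq> 0\<close> reduces this to a relation between squares that follows from
\<open>node_sum\<close>. If \<open>q = 0\<close>, then one of \<open>s\<^sub>1, s\<^sub>4\<close> and one of \<open>r\<^sub>1, r\<^sub>4\<close> vanishes, and they have
different indices because \<open>s\<^sub>i\<^sup>2 + r\<^sub>i\<^sup>2 = d > 0\<close>.\<close>

lemma xi_cross_flow: "mode_xi r (eta_flow p q s) = 0"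
proof -
  have goal: "p * (r$2 * r$4 * s$3 * s$4 + r$1 * r$3 * s$1 * s$2) =
      q * (r$2 * r$4 * s$1 * s$2 + r$1 * r$3 * s$3 * s$4)"
  proof (cases "q = 0")
    case True
    have "s$1 * s$4 = 0" "r$1 * r$4 = 0" using node_s node_r p_nz True by auto
    moreover have "s$1 \<noteq> 0 \<or> r$1 \<noteq> 0" "s$4 \<noteq> 0 \<or> r$4 \<noteq> 0" using sum[of 1] sum[of 4] d by auto
    ultimately have "s$1 * r$1 = 0" "s$4 * r$4 = 0" by auto
    then show ?thesis using True by auto
  next
    case False
    then have "p * s$1 * s$4 \<noteq> 0" "p * r$1 * r$4 \<noteq> 0" using node_s node_r nonzero by simp_all
    then have nz: "r$1 * s$4 * p\<^sup>2 \<noteq> 0" by simp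
    have "p\<^sup>2 * ((r$2)\<^sup>2 * (s$4)\<^sup>2 + (r$1)\<^sup>2 * (s$2)\<^sup>2 - (r$1)\<^sup>2 * (s$4)\<^sup>2) - q\<^sup>2 * (r$2)\<^sup>2 * (s$2)\<^sup>2 = 0"
      unfolding r_square using node_squares node_sum by algebra
    moreover have "(p * (r$2 * r$4 * s$3 * s$4 + r$1 * r$3 * s$1 * s$2) -
      q * (r$2 * r$4 * s$1 * s$2 + r$1 * r$3 * s$3 * s$4)) * (r$1 * s$4 * p\<^sup>2) =
      q * r$3 * s$3 *
        (p\<^sup>2 * ((r$2)\<^sup>2 * (s$4)\<^sup>2 + (r$1)\<^sup>2 * (s$2)\<^sup>2 - (r$1)\<^sup>2 * (s$4)\<^sup>2) - q\<^sup>2 * (r$2)\<^sup>2 * (s$2)\<^sup>2)"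
      using node_s node_r by algebra
    ultimately show ?thesis using nz by simp
  qed
  then show ?thesis unfolding eta_flow_def by simp algebra
qed

text \<open>This is \<open>xi_cross_flow\<close> with the roles of the two modes exchanged: both express the
same kind of vanishing Poisson bracket.\<close>

lemma eta_cross_flow: "mode_eta r (xi_flow p q s) = 0"
proof -
  interpret sw: normal_modes p q d r s by (rule swap)
  show ?thesis using sw.xi_cross_flow unfolding xi_flow_def eta_flow_def by simp algebra
qed

lemma xi_xi_flow: "mode_xi s' (xi_flow p q s'') = 0" and eta_eta_flow: "mode_eta s' (eta_flow p q s'') = 0"
  by (simp_all add: xi_flow_def eta_flow_def)

lemmas mode_flows = xi_eta_flow eta_xi_flow xi_cross_flow eta_cross_flow xi_xi_flow eta_eta_flow

lemma frequency_nz: "mode_frequency p q d s \<noteq> 0"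
  using pq d nonzero p_nz by (simp add: mode_frequency_def)

text \<open>Division by the frequency replaces the products of four \<open>s\<^sub>i\<close> by squares, because of the relation
\<open>p s\<^sub>1 s\<^sub>4 = q s\<^sub>2 s\<^sub>3\<close>. The sum over both modes then simplifies by \<open>s\<^sub>i\<^sup>2 + r\<^sub>i\<^sup>2 = d\<close>.\<close>

lemma mode_wedge:
  "mode_xi s (tangent_vector a b c e) * mode_eta s (tangent_vector a' b' c' e') / mode_frequency p q d s =
    (p * ((s$4)\<^sup>2 * a * b' + (s$1)\<^sup>2 * c * e') - q * ((s$2)\<^sup>2 * a * e' + (s$3)\<^sup>2 * c * b')) / (d * (p\<^sup>2 - q\<^sup>2))"
proof -
  have "p * (mode_xi s (tangent_vector a b c e) * mode_eta s (tangent_vector a' b' c' e')) =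
    s$2 * s$3 * (p * ((s$4)\<^sup>2 * a * b' + (s$1)\<^sup>2 * c * e') - q * ((s$2)\<^sup>2 * a * e' + (s$3)\<^sup>2 * c * b'))"
    unfolding mode_xi_tangent mode_eta_tangent using node_s by algebra
  moreover have "d * (p\<^sup>2 - q\<^sup>2) \<noteq> 0" using d pq by simp
  ultimately show ?thesis
    using p_nz nonzero by (simp add: mode_frequency_def divide_simps) (simp add: algebra_simps)
qed

lemma orb_form_modes:
  assumes u: "u \<in> orb_tangent (M1 p q)" and v: "v \<in> orb_tangent (M1 p q)"
  shows "orb_form (M1 p q) u v =
     - (mode_xi s u * mode_eta s v - mode_eta s u * mode_xi s v) / mode_frequency p q d s
     - (mode_xi r u * mode_eta r v - mode_eta r u * mode_xi r v) / mode_frequency p q d r"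
proof -
  interpret sw: normal_modes p q d r s by (rule swap)
  have *: "mode_xi s u * mode_eta s v / mode_frequency p q d s + mode_xi r u * mode_eta r v / mode_frequency p q d r =
    (p * (a * b' + c * e') - q * (a * e' + c * b')) / (p\<^sup>2 - q\<^sup>2)"
    if "u = tangent_vector a b c e" "v = tangent_vector a' b' c' e'" for u v a b c e a' b' c' e'
  proof -
    have "(p * ((s$4)\<^sup>2 * a * b' + (s$1)\<^sup>2 * c * e') - q * ((s$2)\<^sup>2 * a * e' + (s$3)\<^sup>2 * c * b'))
      + (p * ((r$4)\<^sup>2 * a * b' + (r$1)\<^sup>2 * c * e') - q * ((r$2)\<^sup>2 * a * e' + (r$3)\<^sup>2 * c * b')) =
      d * (p * (a * b' + c * e') - q * (a * e' + c * b'))"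
      unfolding r_square by algebra
    then show ?thesis
      unfolding that mode_wedge sw.mode_wedge add_divide_distrib[symmetric] using d by simp
  qed
  obtain a b c e where u: "u = tangent_vector a b c e"
    using u unfolding orb_tangent_M1[OF pq] by auto
  obtain a' b' c' e' where v: "v = tangent_vector a' b' c' e'"
    using v unfolding orb_tangent_M1[OF pq] by auto
  have "orb_form (M1 p q) u v = (p * (a' * b + c' * e) - q * (a' * e + c' * b)) / (p\<^sup>2 - q\<^sup>2)
      - (p * (a * b' + c * e') - q * (a * e' + c * b')) / (p\<^sup>2 - q\<^sup>2)"
    unfolding u v orb_form_M1[OF pq] diff_divide_distrib[symmetric] by (rule arg_cong2[where f = "(/)"]) (algebra, rule refl)
  also have "\<dots> = mode_xi s v * mode_eta s u / mode_frequency p q d s + mode_xi r v * mode_eta r u / mode_frequency p q d r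
     - (mode_xi s u * mode_eta s v / mode_frequency p q d s + mode_xi r u * mode_eta r v / mode_frequency p q d r)"
    by (simp only: *[OF u v] *[OF v u])
  finally show ?thesis by (simp add: diff_divide_distrib algebra_simps)
qed

text \<open>The division by \<open>sqrt \<bar>k\<bar>\<close> normalizes \<open>orb_form_modes\<close> to the canonical form. The sign is put on
the second half of the coordinates, so that both coordinates of a mode are scaled by the same
modulus and the flow of the mode becomes a rotation.\<close>

definition chart :: "real^4^4 \<Rightarrow> real^4" where
  "chart v = (let k = mode_frequency p q d s; m = mode_frequency p q d r in vector
    [mode_xi s v / sqrt \<bar>k\<bar>, mode_xi r v / sqrt \<bar>m\<bar>,
     - sgn k * mode_eta s v / sqrt \<bar>k\<bar>, - sgn m * mode_eta r v / sqrt \<bar>m\<bar>])"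

lemma linear_chart: "linear chart"
proof -
  show ?thesis
    by (rule linearI) (simp_all add: chart_def Let_def vec_4_eq_iff
      mode_linear algebra_simps add_divide_distrib diff_divide_distrib)
qed

lemma sgn_div_sqrt_abs: "sgn k / (sqrt \<bar>k\<bar> * sqrt \<bar>k\<bar>) = 1 / k" for k :: real
  by (simp add: sgn_if)

lemma chart_symplectic:
  assumes "u \<in> orb_tangent (M1 p q)" "v \<in> orb_tangent (M1 p q)"
  shows "canonical_form (chart u) (chart v) = orb_form (M1 p q) u v"
proof -
  let ?k = "mode_frequency p q d s" and ?m = "mode_frequency p q d r"
  have "canonical_form (chart u) (chart v) =
     - (mode_xi s u * mode_eta s v - mode_eta s u * mode_xi s v) * (sgn ?k / (sqrt \<bar>?k\<bar> * sqrt \<bar>?k\<bar>))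
     - (mode_xi r u * mode_eta r v - mode_eta r u * mode_xi r v) * (sgn ?m / (sqrt \<bar>?m\<bar> * sqrt \<bar>?m\<bar>))"
    unfolding canonical_form_def chart_def Let_def vector_4_nth
    by (simp only: times_divide_eq_left times_divide_eq_right divide_divide_eq_left) (simp add: diff_divide_distrib algebra_simps)
  then show ?thesis
    unfolding sgn_div_sqrt_abs orb_form_modes[OF assms] by simp
qed

lemma flows_in_tangent: "xi_flow p q s' \<in> orb_tangent (M1 p q)" "eta_flow p q s' \<in> orb_tangent (M1 p q)"
  by (auto simp: orb_tangent_M1[OF pq] xi_flow_def eta_flow_def)

lemma subspace_tangent: "subspace (orb_tangent (M1 p q))"
  unfolding orb_tangent_M1[OF pq] subspace_def by (auto simp: tangent_vector_linear) (metis tangent_vector_linear(3))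

text \<open>Injectivity follows from nondegeneracy of the symplectic form. For surjectivity, the flow vectors
are a dual basis of the functions \<open>\<xi>\<close> and \<open>\<eta>\<close> up to the frequencies.\<close>

lemma chart_bij: "bij_betw chart (orb_tangent (M1 p q)) UNIV"
proof (rule bij_betw_imageI)
  interpret sw: normal_modes p q d r s by (rule swap)
  show "inj_on chart (orb_tangent (M1 p q))"
  proof (rule linear_injective_on_subspace_0[OF linear_chart subspace_tangent, THEN iffD2], intro ballI impI)
    fix u assume u: "u \<in> orb_tangent (M1 p q)" and "chart u = 0"
    then have 0: "orb_form (M1 p q) u v = 0" if "v \<in> orb_tangent (M1 p q)" for v
      using chart_symplectic[OF u that] by (simp add: canonical_form_def)
    obtain a b c e where u: "u = tangent_vector a b c e"
      using u unfolding orb_tangent_M1[OF pq] by auto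
    have D: "p\<^sup>2 - q\<^sup>2 \<noteq> 0" using pq by simp
    have "q * (a * e' - e * a' + c * b' - b * c') - p * (a * b' - b * a' + c * e' - e * c') = 0" for a' b' c' e'
      using 0[of "tangent_vector a' b' c' e'"] D unfolding u orb_form_M1[OF pq] orb_tangent_M1[OF pq] by auto
    from this[of 0 1 0 0] this[of 0 0 0 1] this[of 1 0 0 0] this[of 0 0 1 0]
    have "(p\<^sup>2 - q\<^sup>2) * a = 0" "(p\<^sup>2 - q\<^sup>2) * b = 0" "(p\<^sup>2 - q\<^sup>2) * c = 0" "(p\<^sup>2 - q\<^sup>2) * e = 0"
      by algebra+
    then show "u = 0" using D by (simp add: u tangent_vector_linear)
  qed
  show "chart ` orb_tangent (M1 p q) = UNIV"
  proof (intro equalityI subset_UNIV subsetI)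
    fix z :: "real^4"
    let ?k = "mode_frequency p q d s" and ?m = "mode_frequency p q d r"
    let ?v = "(- z$1 * sqrt \<bar>?k\<bar> / ?k) *\<^sub>R eta_flow p q s + (- z$2 * sqrt \<bar>?m\<bar> / ?m) *\<^sub>R eta_flow p q r
      + (- sgn ?k * z$3 * sqrt \<bar>?k\<bar> / ?k) *\<^sub>R xi_flow p q s + (- sgn ?m * z$4 * sqrt \<bar>?m\<bar> / ?m) *\<^sub>R xi_flow p q r"
    have "mode_xi s ?v = z$1 * sqrt \<bar>?k\<bar>" "mode_eta s ?v = - sgn ?k * z$3 * sqrt \<bar>?k\<bar>"
      "mode_xi r ?v = z$2 * sqrt \<bar>?m\<bar>" "mode_eta r ?v = - sgn ?m * z$4 * sqrt \<bar>?m\<bar>"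
      by (simp_all add: mode_linear mode_flows sw.mode_flows
          frequency_nz sw.frequency_nz)
    then have "chart ?v = z"
      using frequency_nz sw.frequency_nz by (simp add: chart_def Let_def vec_4_eq_iff sgn_if)
    moreover have "?v \<in> orb_tangent (M1 p q)"
      by (intro subspace_add[OF subspace_tangent] subspace_mul[OF subspace_tangent] flows_in_tangent)
    ultimately show "z \<in> chart ` orb_tangent (M1 p q)" by (metis image_eqI)
  qed
qed

lemma chart_linearized_field:
  assumes v: "v \<in> orb_tangent (M1 p q)"
    and f: "\<And>i j. i \<noteq> j \<Longrightarrow> f i j = \<alpha> * mode_weight s i j + \<beta> * mode_weight r i j + \<gamma>"
  shows "linearized_field p q f v \<in> orb_tangent (M1 p q)"
    "chart (linearized_field p q f v) =
      center_center_matrix (- \<alpha> * \<bar>mode_frequency p q d s\<bar>) (- \<beta> * \<bar>mode_frequency p q d r\<bar>) *v chart v"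
proof -
  interpret sw: normal_modes p q d r s by (rule swap)
  let ?k = "mode_frequency p q d s" and ?m = "mode_frequency p q d r"
  have eq: "linearized_field p q f v =
      \<alpha> *\<^sub>R (mode_xi s v *\<^sub>R xi_flow p q s + mode_eta s v *\<^sub>R eta_flow p q s)
      + \<beta> *\<^sub>R (mode_xi r v *\<^sub>R xi_flow p q r + mode_eta r v *\<^sub>R eta_flow p q r)"
    using linearized_field_linear[OF pq v, of f \<alpha> "mode_weight s" \<beta> "mode_weight r" \<gamma>, OF f]
    unfolding linearized_field_mode_weight[OF pq node_s v] linearized_field_mode_weight[OF pq node_r v] .
  show "linearized_field p q f v \<in> orb_tangent (M1 p q)"
    unfolding eq
    by (intro subspace_add[OF subspace_tangent] subspace_mul[OF subspace_tangent] flows_in_tangent)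
  have "mode_xi s (linearized_field p q f v) = - \<alpha> * ?k * mode_eta s v"
    "mode_eta s (linearized_field p q f v) = \<alpha> * ?k * mode_xi s v"
    "mode_xi r (linearized_field p q f v) = - \<beta> * ?m * mode_eta r v"
    "mode_eta r (linearized_field p q f v) = \<beta> * ?m * mode_xi r v"
    unfolding eq
    by (simp_all add: mode_linear mode_flows sw.mode_flows)
  then show "chart (linearized_field p q f v) =
      center_center_matrix (- \<alpha> * \<bar>?k\<bar>) (- \<beta> * \<bar>?m\<bar>) *v chart v"
    by (simp add: chart_def Let_def vec_4_eq_iff matrix_vector_mult_def sum_4 abs_sgn sgn_if)
qed

end

section \<open>Lyapunov stability\<close>

text \<open>The minimum of \<open>V\<close> on a small sphere around \<open>M\<close> in \<open>S\<close> is positive. A solution that starts near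
\<open>M\<close>, with \<open>V\<close> below this minimum, would have to cross the sphere to escape, which
conservation of \<open>V\<close> excludes.\<close>

lemma lyapunov_stable_if_conserved:
  fixes f :: "'a::{heine_borel, real_normed_vector} \<Rightarrow> 'a" and V :: "'a \<Rightarrow> real"
  assumes S: "closed S" "M \<in> S" and "f M = 0" and V: "continuous_on S V" "V M = 0"
    and "\<rho> > 0" and pos: "\<And>N. N \<in> S \<Longrightarrow> N \<noteq> M \<Longrightarrow> dist N M < \<rho> \<Longrightarrow> V N > 0"
    and conserved: "\<And>T \<gamma> t. solution_on f S T \<gamma> \<Longrightarrow> t \<in> {0..T} \<Longrightarrow> V (\<gamma> t) = V (\<gamma> 0)"
  shows "lyapunov_stable f S M"
  unfolding lyapunov_stable_def
proof (intro conjI allI impI assms)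
  fix \<epsilon> :: real assume "\<epsilon> > 0"
  \<comment> \<open>half of \<open>\<rho>\<close>, because \<open>V\<close> is known to be positive only strictly inside the ball\<close>
  define e where "e = min \<epsilon> (\<rho> / 2)"
  have e: "e > 0" "e \<le> \<epsilon>" "e < \<rho>" using \<open>\<epsilon> > 0\<close> \<open>\<rho> > 0\<close> by (auto simp: e_def)
  let ?K = "S \<inter> sphere M e"
  obtain m where m: "m > 0" "\<And>N. N \<in> ?K \<Longrightarrow> m \<le> V N"
  proof (cases "?K = {}")
    case True
    then show thesis using that[of 1] by auto
  next
    case False
    have "compact ?K"
      unfolding compact_eq_bounded_closed cball_diff_eq_sphere[symmetric]
      by (intro conjI closed_Int S(1) closed_Diff closed_cball open_ball
          bounded_subset[OF bounded_cball[of M e]]) auto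
    moreover have "continuous_on ?K V" using V(1) by (rule continuous_on_subset) auto
    ultimately obtain N where N: "N \<in> ?K" "\<And>N'. N' \<in> ?K \<Longrightarrow> V N \<le> V N'"
      using continuous_attains_inf[OF _ False] by blast
    have "V N > 0" using N(1) e by (intro pos) (auto simp: dist_commute)
    then show thesis using that N(2) by blast
  qed
  from V(1) S(2) m(1) obtain \<delta> where \<delta>: "\<delta> > 0" "\<And>N. N \<in> S \<Longrightarrow> dist N M < \<delta> \<Longrightarrow> dist (V N) (V M) < m"
    unfolding continuous_on_iff by metis
  show "\<exists>\<delta>>0. \<forall>T\<ge>0. \<forall>\<gamma>. solution_on f S T \<gamma> \<and> dist (\<gamma> 0) M < \<delta> \<longrightarrow> (\<forall>t\<in>{0..T}. dist (\<gamma> t) M < \<epsilon>)"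
  proof (intro exI[of _ "min \<delta> e"] conjI allI impI ballI; (elim conjE)?)
    fix T t :: real and \<gamma>
    assume sol: "solution_on f S T \<gamma>" and start: "dist (\<gamma> 0) M < min \<delta> e" and t: "t \<in> {0..T}"
    have in_S: "\<gamma> u \<in> S" if "u \<in> {0..T}" for u using sol that by (simp add: solution_on_def)
    have "continuous_on {0..T} \<gamma>"
      using sol unfolding solution_on_def continuous_on_eq_continuous_within
      by (blast intro: has_vector_derivative_continuous)
    then have cont: "continuous_on {0..t} (\<lambda>u. dist (\<gamma> u) M)"
      using t by (intro continuous_intros) (auto elim: continuous_on_subset)
    show "dist (\<gamma> t) M < \<epsilon>"
    proof (rule ccontr)
      assume "\<not> dist (\<gamma> t) M < \<epsilon>"
      then obtain u where u: "0 \<le> u" "u \<le> t" "dist (\<gamma> u) M = e"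
        using IVT'[OF _ _ _ cont, of e] start t e by auto
      then have "m \<le> V (\<gamma> u)" using t by (intro m(2)) (auto simp: in_S dist_commute)
      also have "V (\<gamma> u) = V (\<gamma> 0)" using u t by (intro conserved[OF sol]) auto
      also have "dist (V (\<gamma> 0)) (V M) < m" using start t by (intro \<delta>(2) in_S) auto
      then have "V (\<gamma> 0) < m" by (simp add: V(2) dist_real_def)
      finally show False by simp
    qed
  qed (use \<delta>(1) e(1) in auto)
qed

lemma lyapunov_stable_subset:
  assumes "lyapunov_stable f S M" "S' \<subseteq> S" "M \<in> S'"
  shows "lyapunov_stable f S' M"
proof -
  have "solution_on f S T \<gamma>" if "solution_on f S' T \<gamma>" for T \<gamma>
    using that assms(2) by (auto simp: solution_on_def)
  then show ?thesis
    using assms(1,3) unfolding lyapunov_stable_def by meson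
qed

lemma first_integral_conserved:
  assumes deriv: "\<And>N. N \<in> so4 \<Longrightarrow> (F has_derivative so4_inner (G N)) (at N within so4)"
    and zero: "\<And>N. N \<in> so4 \<Longrightarrow> so4_inner (G N) (f N) = 0"
    and sol: "solution_on f so4 T \<gamma>" and t: "t \<in> {0..T}"
  shows "F (\<gamma> t) = (F (\<gamma> 0) :: real)"
proof (rule has_derivative_zero_unique[where s = "{0..T}" and f = "\<lambda>t. F (\<gamma> t)"])
  fix u assume u: "u \<in> {0..T}"
  then have \<gamma>: "\<gamma> u \<in> so4" "(\<gamma> has_derivative (\<lambda>h. h *\<^sub>R f (\<gamma> u))) (at u within {0..T})"
    using sol by (auto simp: solution_on_def has_vector_derivative_def)
  have "\<gamma> ` {0..T} \<subseteq> so4" using sol by (auto simp: solution_on_def)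
  then have "((\<lambda>t. F (\<gamma> t)) has_derivative (\<lambda>h. so4_inner (G (\<gamma> u)) (h *\<^sub>R f (\<gamma> u)))) (at u within {0..T})"
    using has_derivative_in_compose[OF \<gamma>(2) has_derivative_subset[OF deriv[OF \<gamma>(1)]]] by blast
  moreover have "(\<lambda>h. so4_inner (G (\<gamma> u)) (h *\<^sub>R f (\<gamma> u))) = (\<lambda>h. 0)"
    using zero[OF \<gamma>(1)]
    by (simp add: linear_scale[OF bounded_linear.linear[OF bounded_linear_so4_inner]])
  ultimately show "((\<lambda>t. F (\<gamma> t)) has_derivative (\<lambda>h. 0)) (at u within {0..T})" by simp
qed (use t in auto)

text \<open>The gradient of \<^const>\<open>casimir2\<close> on \<^const>\<open>so4\<close>.\<close>

definition swap_xy :: "real^4^4 \<Rightarrow> real^4^4" where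
  "swap_xy M = so4_matrix (y_coords M) (x_coords M)"

lemma casimir2_has_derivative:
  assumes "M \<in> so4"
  shows "(casimir2 has_derivative so4_inner (swap_xy M)) (at M within so4)"
proof -
  have "(casimir2 has_derivative (\<lambda>X. x_coords M \<bullet> y_coords X + x_coords X \<bullet> y_coords M)) (at M within so4)"
  proof -
    have *: "casimir2 = (\<lambda>N. x_coords N \<bullet> y_coords N)" by (simp add: fun_eq_iff casimir2_def inner_vec_def)
    show ?thesis
      unfolding * by (intro has_derivative_inner bounded_linear_imp_has_derivative
        bounded_linear_x_coords bounded_linear_y_coords)
  qed
  then show ?thesis
  proof (rule has_derivative_within_subspace_cong[OF _ subspace_so4 assms bounded_linear_so4_inner])
    fix X :: "real^4^4" assume "X \<in> so4"
    then obtain x y where "X = so4_matrix x y" by (rule so4_cases)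
    then show "x_coords M \<bullet> y_coords X + x_coords X \<bullet> y_coords M = so4_inner (swap_xy M) X"
      by (simp add: swap_xy_def so4_inner_so4_matrix inner_commute)
  qed
qed

lemma casimir2_in_involution:
  assumes "M \<in> so4" shows "so4_inner (swap_xy M) (diagonal_field h M) = 0"
proof -
  obtain x y where M: "M = so4_matrix x y" using assms by (rule so4_cases)
  show ?thesis
    by (simp add: M swap_xy_def diagonal_field_def diagonal_operator_def lie_bracket_so4_matrix
        so4_inner_so4_matrix inner_vec_def sum_3 cross3_def algebra_simps)
qed

text \<open>The Poisson bracket of two diagonal forms is a cubic form whose monomials are the
products of the entries of \<open>M\<close> along the four triangles in the complete graph on
\<open>{1, 2, 3, 4}\<close>. Up to sign, the coefficient of a triangle is the determinant of the weights \<open>1, f, h\<close> on its three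
edges.\<close>

lemma diagonal_forms_in_involution:
  assumes "M \<in> so4"
    and 123: "f 2 3 * (h 1 2 - h 1 3) + f 1 3 * (h 2 3 - h 1 2) + f 1 2 * (h 1 3 - h 2 3) = 0"
    and 234: "f 2 3 * (h 3 4 - h 2 4) + f 2 4 * (h 2 3 - h 3 4) + f 3 4 * (h 2 4 - h 2 3) = 0"
    and 134: "f 1 3 * (h 1 4 - h 3 4) + f 1 4 * (h 3 4 - h 1 3) + f 3 4 * (h 1 3 - h 1 4) = 0"
    and 124: "f 1 2 * (h 2 4 - h 1 4) + f 1 4 * (h 1 2 - h 2 4) + f 2 4 * (h 1 4 - h 1 2) = 0"
  shows "so4_inner (diagonal_operator f M) (diagonal_field h M) = 0"
proof -
  obtain x y where M: "M = so4_matrix x y" using assms(1) by (rule so4_cases)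
  have "so4_inner (diagonal_operator f M) (diagonal_field h M) =
     x$1 * x$2 * x$3 * (f 2 3 * (h 1 2 - h 1 3) + f 1 3 * (h 2 3 - h 1 2) + f 1 2 * (h 1 3 - h 2 3))
   + x$1 * y$2 * y$3 * (f 2 3 * (h 3 4 - h 2 4) + f 2 4 * (h 2 3 - h 3 4) + f 3 4 * (h 2 4 - h 2 3))
   + x$2 * y$1 * y$3 * (f 1 3 * (h 1 4 - h 3 4) + f 1 4 * (h 3 4 - h 1 3) + f 3 4 * (h 1 3 - h 1 4))
   + x$3 * y$1 * y$2 * (f 1 2 * (h 2 4 - h 1 4) + f 1 4 * (h 1 2 - h 2 4) + f 2 4 * (h 1 4 - h 1 2))"
    by (simp add: M diagonal_field_def diagonal_operator_def lie_bracket_so4_matrix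
        so4_inner_so4_matrix inner_vec_def sum_3 cross3_def algebra_simps)
  then show ?thesis using 123 234 134 124 by simp
qed

definition mode_energy :: "real^4 \<Rightarrow> real^4^4 \<Rightarrow> real" where
  "mode_energy s M = 2 * diagonal_form (mode_weight s) M - 2 * (s$1 * s$2 * s$3 * s$4) * casimir2 M"

lemma mode_energy_squares:
  "mode_energy s M = (s$1 * s$4 * x_coords M $ 1 - s$2 * s$3 * y_coords M $ 1)\<^sup>2
     + (mode_xi s M)\<^sup>2 + (mode_eta s M)\<^sup>2"
  by (simp add: mode_energy_def diagonal_form_def casimir2_def sum_3 mode_xi_def mode_eta_def
      power2_eq_square algebra_simps)

context normal_modes
begin

text \<open>On the triangle that omits the vertex \<open>m\<close>, the complement of each edge contains \<open>m\<close>, so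
both \<open>mode_weight s\<close> and \<open>mode_weight r\<close> are affine functions of \<open>s\<^sub>k\<^sup>2\<close>, where \<open>k\<close> is the vertex
opposite to the edge. Hence \<open>1, mode_weight s, mode_weight r\<close> are linearly dependent on each
triangle.\<close>

lemma mode_weight_in_involution:
  assumes "M \<in> so4"
    and h: "\<And>i j. i \<noteq> j \<Longrightarrow> h i j = \<alpha> * mode_weight s i j + \<beta> * mode_weight r i j + \<gamma>"
  shows "so4_inner (diagonal_operator (mode_weight s) M) (diagonal_field h M) = 0"
proof (rule diagonal_forms_in_involution[OF assms(1)])
  have h': "h 2 3 = \<alpha> * (s$1 * s$4)\<^sup>2 + \<beta> * ((d - (s$1)\<^sup>2) * (d - (s$4)\<^sup>2)) + \<gamma>"
    "h 1 3 = \<alpha> * (s$2 * s$4)\<^sup>2 + \<beta> * ((d - (s$2)\<^sup>2) * (d - (s$4)\<^sup>2)) + \<gamma>"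
    "h 1 2 = \<alpha> * (s$3 * s$4)\<^sup>2 + \<beta> * ((d - (s$3)\<^sup>2) * (d - (s$4)\<^sup>2)) + \<gamma>"
    "h 1 4 = \<alpha> * (s$2 * s$3)\<^sup>2 + \<beta> * ((d - (s$2)\<^sup>2) * (d - (s$3)\<^sup>2)) + \<gamma>"
    "h 2 4 = \<alpha> * (s$1 * s$3)\<^sup>2 + \<beta> * ((d - (s$1)\<^sup>2) * (d - (s$3)\<^sup>2)) + \<gamma>"
    "h 3 4 = \<alpha> * (s$1 * s$2)\<^sup>2 + \<beta> * ((d - (s$1)\<^sup>2) * (d - (s$2)\<^sup>2)) + \<gamma>"
    by (simp_all add: h power_mult_distrib r_square)
  show "mode_weight s 2 3 * (h 1 2 - h 1 3) + mode_weight s 1 3 * (h 2 3 - h 1 2) + mode_weight s 1 2 * (h 1 3 - h 2 3) = 0"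
    "mode_weight s 2 3 * (h 3 4 - h 2 4) + mode_weight s 2 4 * (h 2 3 - h 3 4) + mode_weight s 3 4 * (h 2 4 - h 2 3) = 0"
    "mode_weight s 1 3 * (h 1 4 - h 3 4) + mode_weight s 1 4 * (h 3 4 - h 1 3) + mode_weight s 3 4 * (h 1 3 - h 1 4) = 0"
    "mode_weight s 1 2 * (h 2 4 - h 1 4) + mode_weight s 1 4 * (h 1 2 - h 2 4) + mode_weight s 2 4 * (h 1 4 - h 1 2) = 0"
    unfolding mode_weight_simps h' by algebra+
qed

text \<open>When all six squares vanish, \<open>chart_bij\<close> kills the coordinates with indices \<open>2\<close> and \<open>3\<close>,
and the remaining square puts \<open>(x\<^sub>1, y\<^sub>1)\<close> on the line through \<open>(p, q)\<close>. The level of \<open>C\<^sub>1\<close> leaves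
the two points of this line at distance \<open>sqrt (p\<^sup>2 + q\<^sup>2)\<close> from the origin.\<close>

lemma mode_energy_zero:
  assumes "N \<in> so4" and "mode_energy s N = 0" "mode_energy r N = 0" and c: "casimir1 N = (p\<^sup>2 + q\<^sup>2) / 2"
  shows "N = M1 p q \<or> N = - M1 p q"
proof -
  obtain x y where N: "N = so4_matrix x y" using assms(1) by (rule so4_cases)
  have sq: "a\<^sup>2 + b\<^sup>2 + c\<^sup>2 = 0 \<Longrightarrow> a = 0 \<and> b = 0 \<and> c = 0" for a b c :: real
    by (metis add_nonneg_eq_0_iff zero_le_power2 add_nonneg_nonneg power_eq_0_iff)
  have 1: "s$1 * s$4 * x$1 - s$2 * s$3 * y$1 = 0" "mode_xi s N = 0" "mode_eta s N = 0"
    using assms(2) unfolding mode_energy_squares by (auto dest!: sq simp: N)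
  have 2: "mode_xi r N = 0" "mode_eta r N = 0"
    using assms(3) unfolding mode_energy_squares by (auto dest!: sq)
  have v: "tangent_vector (x$2) (x$3) (y$2) (y$3) \<in> orb_tangent (M1 p q)"
    unfolding orb_tangent_M1[OF pq] by blast
  have "chart (tangent_vector (x$2) (x$3) (y$2) (y$3)) = 0"
    using 1(2,3) 2 by (simp add: chart_def Let_def vec_4_eq_iff N mode_xi_def mode_eta_def tangent_vector_def)
  then have "tangent_vector (x$2) (x$3) (y$2) (y$3) = 0"
    using chart_bij v linear_0[OF linear_chart] subspace_0[OF subspace_tangent]
    by (metis bij_betw_imp_inj_on inj_onD)
  then have 0: "x$2 = 0" "x$3 = 0" "y$2 = 0" "y$3 = 0"
    unfolding tangent_vector_linear(3)[symmetric] tangent_vector_eq_iff by auto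
  have "s$2 * s$3 * (q * x$1) = s$2 * s$3 * (p * y$1)" using 1(1) node_s by algebra
  then have y: "q * x$1 = p * y$1" using nonzero by simp
  have "(x$1)\<^sup>2 + (y$1)\<^sup>2 = p\<^sup>2 + q\<^sup>2"
    using c unfolding N casimir1_so4_matrix by (simp add: inner_vec_def sum_3 0 power2_eq_square)
  then have "(p\<^sup>2 + q\<^sup>2) * (x$1)\<^sup>2 = (p\<^sup>2 + q\<^sup>2) * p\<^sup>2" using y by algebra
  moreover have "p\<^sup>2 + q\<^sup>2 \<noteq> 0" using p_nz by (simp add: sum_power2_eq_zero_iff)
  ultimately have "x$1 = p \<or> x$1 = - p" by (auto simp: power2_eq_iff p_nz)
  then show ?thesis
  proof
    assume "x$1 = p"
    then show ?thesis using y p_nz 0 by (simp add: N M1_def vec_3_eq_iff)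
  next
    assume "x$1 = - p"
    then have "p * y$1 = p * (- q)" using y by (simp add: mult.commute)
    then have "y$1 = - q" using p_nz by (simp only: mult_cancel_left simp_thms)
    then have "N = so4_matrix (- vector [p, 0, 0]) (- vector [q, 0, 0])"
      using \<open>x$1 = - p\<close> 0 by (simp add: N vec_3_eq_iff)
    also have "\<dots> = - M1 p q"
      using so4_matrix_scale[of "-1"] by (simp add: M1_def)
    finally show ?thesis by simp
  qed
qed

text \<open>The sum of the two mode energies and \<open>(C\<^sub>1 - c\<^sub>1)\<^sup>2\<close> is a nonnegative first integral that
vanishes only at the equilibrium and its negative, so it is positive in the punctured ball whose
radius is the distance of these two points.\<close>

lemma M1_stable:
  assumes h: "\<And>i j. i \<noteq> j \<Longrightarrow> h i j = \<alpha> * mode_weight s i j + \<beta> * mode_weight r i j + \<gamma>"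
    and f: "\<And>N. N \<in> so4 \<Longrightarrow> f N = diagonal_field h N"
  shows "lyapunov_stable f so4 (M1 p q)"
proof (rule lyapunov_stable_if_conserved)
  interpret sw: normal_modes p q d r s by (rule swap)
  let ?c = "(p\<^sup>2 + q\<^sup>2) / 2"
  let ?V = "\<lambda>N. mode_energy s N + mode_energy r N + (casimir1 N - ?c)\<^sup>2"
  have nonneg: "mode_energy s' N \<ge> 0" for s' N unfolding mode_energy_squares by simp
  show "closed so4" by (rule closed_subspace[OF subspace_so4])
  show "f (M1 p q) = 0" by (simp add: f diagonal_field_M1)
  have cont: "continuous_on so4 (diagonal_form g)" for g
    unfolding continuous_on_eq_continuous_within
    using diagonal_form_has_derivative has_derivative_continuous by blast
  have "continuous_on so4 casimir2"
    unfolding continuous_on_eq_continuous_within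
    using casimir2_has_derivative has_derivative_continuous by blast
  then show "continuous_on so4 ?V"
    unfolding mode_energy_def [abs_def] casimir1_eq_diagonal_form by (intro continuous_intros cont)
  have C: "casimir1 (M1 p q) = ?c"
    by (simp add: M1_def casimir1_so4_matrix inner_vec_def sum_3 power2_eq_square)
  then show "?V (M1 p q) = 0"
    using node_s node_r by (simp add: mode_energy_squares mode_xi_def mode_eta_def M1_def mult_ac)
  have "M1 p q \<noteq> - M1 p q"
  proof
    assume "M1 p q = - M1 p q"
    from arg_cong[OF this, of "\<lambda>M. M $ 3 $ 2"] show False using p_nz by (simp add: M1_def)
  qed
  then show "dist (M1 p q) (- M1 p q) > 0" by simp
  show "?V N > 0" if "N \<in> so4" "N \<noteq> M1 p q" "dist N (M1 p q) < dist (M1 p q) (- M1 p q)" for N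
  proof -
    have "N \<noteq> - M1 p q" using that(3) by (auto simp: dist_commute)
    then have "mode_energy s N \<noteq> 0 \<or> mode_energy r N \<noteq> 0 \<or> casimir1 N - ?c \<noteq> 0"
      using mode_energy_zero that(1,2) by auto
    then show ?thesis
      using nonneg[of s N] nonneg[of r N] zero_le_power2[of "casimir1 N - ?c"]
      by (smt (verit) zero_less_power2)
  qed
  fix T c t assume sol: "solution_on f so4 T c" and t: "t \<in> {0..T}"
  have "diagonal_form (mode_weight s) (c t) = diagonal_form (mode_weight s) (c 0)"
    by (rule first_integral_conserved[OF diagonal_form_has_derivative _ sol t])
      (simp_all add: f mode_weight_in_involution[OF _ h])
  moreover have "diagonal_form (mode_weight r) (c t) = diagonal_form (mode_weight r) (c 0)"
    by (rule first_integral_conserved[OF diagonal_form_has_derivative _ sol t])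
      (simp_all add: f sw.mode_weight_in_involution[of _ h \<beta> \<alpha> \<gamma>] h)
  moreover have "casimir1 (c t) = casimir1 (c 0)"
    unfolding casimir1_eq_diagonal_form
    by (rule first_integral_conserved[OF diagonal_form_has_derivative _ sol t])
      (simp_all add: f diagonal_forms_in_involution)
  moreover have "casimir2 (c t) = casimir2 (c 0)"
    by (rule first_integral_conserved[OF casimir2_has_derivative _ sol t])
      (simp_all add: f casimir2_in_involution)
  ultimately show "?V (c t) = ?V (c 0)"
    by (simp add: mode_energy_def)
qed simp

end

section \<open>Existence of the normal modes and the theorem\<close>

lemma quadratic_roots_beyond_nonpositive_point:
  fixes A B C x :: real
  assumes "A > 0" and "A * x\<^sup>2 + B * x + C \<le> 0"
  obtains t t' where "t' \<le> x" "x \<le> t" "A * t\<^sup>2 + B * t + C = 0" "A * t'\<^sup>2 + B * t' + C = 0"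
proof -
  define D where "D = B\<^sup>2 - 4 * A * C"
  have "4 * A * (A * x\<^sup>2 + B * x + C) \<le> 0" using assms by (simp add: mult_nonneg_nonpos)
  then have le: "(2 * A * x + B)\<^sup>2 \<le> D" by (simp add: D_def power2_eq_square algebra_simps)
  then have D: "D \<ge> 0" using zero_le_power2 order_trans by blast
  have abs: "\<bar>2 * A * x + B\<bar> \<le> sqrt D" using le by (simp add: real_le_rsqrt sqrt_le_D flip: real_sqrt_abs)
  have root: "A * t\<^sup>2 + B * t + C = 0" if "2 * A * t + B = u" "u\<^sup>2 = D" for t u
  proof -
    have "4 * A * (A * t\<^sup>2 + B * t + C) = (2 * A * t + B)\<^sup>2 - D"
      by (simp add: D_def power2_eq_square algebra_simps)
    then have "4 * A * (A * t\<^sup>2 + B * t + C) = 0" using that by simp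
    then show ?thesis using assms by simp
  qed
  show thesis
  proof
    show "A * ((- B + sqrt D) / (2 * A))\<^sup>2 + B * ((- B + sqrt D) / (2 * A)) + C = 0"
      using assms D by (intro root[of _ "sqrt D"]) auto
    show "A * ((- B - sqrt D) / (2 * A))\<^sup>2 + B * ((- B - sqrt D) / (2 * A)) + C = 0"
      using assms D by (intro root[of _ "- sqrt D"]) auto
    show "x \<le> (- B + sqrt D) / (2 * A)" "(- B - sqrt D) / (2 * A) \<le> x"
      using abs assms by (auto simp: field_simps abs_le_iff)
  qed
qed

text \<open>The square roots of \<open>t - L\<^sub>i\<close> and \<open>L\<^sub>i - t'\<close> are determined up to sign. All of them are taken
positive except \<open>s\<^sub>1\<close> and \<open>r\<^sub>4\<close>, which are defined by the linear relations; the choice of \<open>t\<close> and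
\<open>t'\<close> ensures that they have the right squares. In this way no sign of \<open>p\<close> or \<open>q\<close> has to be
distinguished.\<close>

lemma normal_modes_exist:
  fixes L :: "real^4"
  assumes L: "L$1 > L$2" "L$2 > L$3" "L$3 > L$4" and pq: "q\<^sup>2 < p\<^sup>2"
  obtains t t' s r where "normal_modes p q (t - t') s r"
    "\<forall>i. (s$i)\<^sup>2 = t - L$i" "\<forall>i. (r$i)\<^sup>2 = L$i - t'"
proof -
  let ?g = "\<lambda>t. p\<^sup>2 * ((t - L$1) * (t - L$4)) - q\<^sup>2 * ((t - L$2) * (t - L$3))"
  let ?B = "q\<^sup>2 * (L$2 + L$3) - p\<^sup>2 * (L$1 + L$4)" and ?C = "p\<^sup>2 * (L$1 * L$4) - q\<^sup>2 * (L$2 * L$3)"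
  have g: "?g t = (p\<^sup>2 - q\<^sup>2) * t\<^sup>2 + ?B * t + ?C" for t
    by (simp add: power2_eq_square algebra_simps)
  have p: "p \<noteq> 0" using pq by auto
  have pos: "0 \<le> q\<^sup>2 * ((L$1 - L$2) * (L$1 - L$3))" "0 \<le> q\<^sup>2 * ((L$2 - L$4) * (L$3 - L$4))"
    using L by simp_all
  obtain t where t: "L$1 \<le> t" "?g t = 0"
  proof (rule quadratic_roots_beyond_nonpositive_point[of "p\<^sup>2 - q\<^sup>2" "L$1" ?B ?C], unfold g[symmetric])
    show "?g (L$1) \<le> 0" using pos(1) by simp
  qed (use pq in auto)
  obtain t' where t': "t' \<le> L$4" "?g t' = 0"
  proof (rule quadratic_roots_beyond_nonpositive_point[of "p\<^sup>2 - q\<^sup>2" "L$4" ?B ?C], unfold g[symmetric])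
    show "?g (L$4) \<le> 0" using pos(2) by (simp add: algebra_simps)
  qed (use pq in auto)
  define s2 s3 s4 where "s2 = sqrt (t - L$2)" and "s3 = sqrt (t - L$3)" and "s4 = sqrt (t - L$4)"
  define r1 r2 r3 where "r1 = sqrt (L$1 - t')" and "r2 = sqrt (L$2 - t')" and "r3 = sqrt (L$3 - t')"
  define s1 r4 where "s1 = q * s2 * s3 / (p * s4)" and "r4 = q * r2 * r3 / (p * r1)"
  have sq: "s2\<^sup>2 = t - L$2" "s3\<^sup>2 = t - L$3" "s4\<^sup>2 = t - L$4" "r1\<^sup>2 = L$1 - t'" "r2\<^sup>2 = L$2 - t'" "r3\<^sup>2 = L$3 - t'"
    using L t t' by (simp_all add: s2_def s3_def s4_def r1_def r2_def r3_def)
  have nz: "s2 \<noteq> 0" "s3 \<noteq> 0" "s4 \<noteq> 0" "r1 \<noteq> 0" "r2 \<noteq> 0" "r3 \<noteq> 0"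
    using L t(1) t'(1) by (simp_all add: s2_def s3_def s4_def r1_def r2_def r3_def)
  have "(p * s4)\<^sup>2 * (t - L$1) = (q * s2 * s3)\<^sup>2"
    using t(2) by (simp add: power_mult_distrib sq algebra_simps)
  then have s1: "s1\<^sup>2 = t - L$1" using p nz by (simp add: s1_def power_divide nonzero_divide_eq_eq mult.commute)
  have "(p * r1)\<^sup>2 * (L$4 - t') = (q * r2 * r3)\<^sup>2"
    using t'(2) by (simp add: power_mult_distrib sq algebra_simps)
  then have r4: "r4\<^sup>2 = L$4 - t'" using p nz by (simp add: r4_def power_divide nonzero_divide_eq_eq mult.commute)
  show thesis
  proof
    have s: "((vector [s1, s2, s3, s4] :: real^4) $ i)\<^sup>2 = t - L$i" for i
      using exhaust_4[of i] sq s1 by auto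
    have r: "((vector [r1, r2, r3, r4] :: real^4) $ i)\<^sup>2 = L$i - t'" for i
      using exhaust_4[of i] sq r4 by auto
    then show "\<forall>i. ((vector [s1, s2, s3, s4] :: real^4) $ i)\<^sup>2 = t - L$i"
      "\<forall>i. ((vector [r1, r2, r3, r4] :: real^4) $ i)\<^sup>2 = L$i - t'" using s by blast+
    show "normal_modes p q (t - t') (vector [s1, s2, s3, s4]) (vector [r1, r2, r3, r4])"
    proof
      show "((vector [s1, s2, s3, s4] :: real^4) $ i)\<^sup>2 + ((vector [r1, r2, r3, r4] :: real^4) $ i)\<^sup>2 = t - t'" for i
        unfolding s r by simp
    qed (use pq L t(1) t'(1) nz p in \<open>simp_all add: s1_def r4_def\<close>)
  qed
qed

lemma pairs_4_cases:
  assumes "\<And>i j. P i j \<Longrightarrow> P j i" "P 2 3" "P 1 3" "P 1 2" "P 1 4" "P 2 4" "P 3 4" and "i \<noteq> (j::4)"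
  shows "P i j"
  using exhaust_4[of i] exhaust_4[of j] assms by metis

text \<open>Write \<open>L\<^sub>k, L\<^sub>m\<close> for the entries at the complement of \<open>{i, j}\<close>. For varying \<open>t\<close> the product
\<open>(t - L\<^sub>k) (t - L\<^sub>m)\<close> is affine in \<open>L\<^sub>k L\<^sub>m\<close> and \<open>L\<^sub>k + L\<^sub>m\<close>, and two values of \<open>t\<close> suffice to solve
for these.\<close>

lemma affine_in_mode_weights:
  fixes L :: "real^4"
  assumes s: "\<And>i. (s$i)\<^sup>2 = t - L$i" and r: "\<And>i. (r$i)\<^sup>2 = L$i - t'" and tt: "t \<noteq> t'" and ij: "i \<noteq> j"
  shows "A * (\<Prod>k\<in>-{i, j}. L$k) + B * (\<Sum>k\<in>-{i, j}. L$k) + C =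
     - (A * t' + B) / (t - t') * mode_weight s i j + (A * t + B) / (t - t') * mode_weight r i j
     + (A * t * t' + B * (t + t') + C)"
proof -
  have "card (-{i, j}) = 2"
    using ij by (simp add: Compl_eq_Diff_UNIV card_Diff_subset)
  then obtain k m where km: "-{i, j} = {k, m}" "k \<noteq> m"
    by (meson card_2_iff)
  have "(A * (L$k * L$m) + B * (L$k + L$m) - (A * t * t' + B * (t + t'))) * (t - t') =
     - (A * t' + B) * ((t - L$k) * (t - L$m)) + (A * t + B) * ((L$k - t') * (L$m - t'))"
    by algebra
  then have "A * (L$k * L$m) + B * (L$k + L$m) - (A * t * t' + B * (t + t')) =
     - (A * t' + B) / (t - t') * ((t - L$k) * (t - L$m)) + (A * t + B) / (t - t') * ((L$k - t') * (L$m - t'))"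
    using tt by (simp add: add_divide_distrib[symmetric] nonzero_eq_divide_eq flip: minus_divide_left)
  then show ?thesis using km by (simp add: mode_weight_def s r)
qed

text \<open>This places the energy in the pencil of the integrals \<open>F\<^sub>t\<close>. With \<open>e\<^sub>1, \<dots>, e\<^sub>4\<close> the elementary
symmetric polynomials in the \<open>\<lambda>\<^sub>i\<close>, \<open>P\<close> the product of all six sums \<open>\<lambda>\<^sub>i + \<lambda>\<^sub>j\<close>, and \<open>k, m\<close> the complementary
indices, the identity is
\<open>P / (\<lambda>\<^sub>i + \<lambda>\<^sub>j) = e\<^sub>1 \<lambda>\<^sub>k\<^sup>2 \<lambda>\<^sub>m\<^sup>2 + e\<^sub>3 (\<lambda>\<^sub>k\<^sup>2 + \<lambda>\<^sub>m\<^sup>2) + e\<^sub>2 e\<^sub>3 - e\<^sub>1 e\<^sub>4\<close>.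
Positivity of the coefficient of the product makes the energy independent of \<open>I\<close>.\<close>

lemma inverse_sum_via_complement:
  fixes l :: "real^4"
  assumes l: "\<And>i j. i \<noteq> j \<Longrightarrow> l$i + l$j > 0"
  obtains A B C where "A > 0"
    "\<forall>i j. i \<noteq> j \<longrightarrow> 1 / (l$i + l$j) = A * (\<Prod>k\<in>-{i, j}. (l$k)\<^sup>2) + B * (\<Sum>k\<in>-{i, j}. (l$k)\<^sup>2) + C"
proof -
  define P where "P = (l$2 + l$3) * (l$1 + l$3) * (l$1 + l$2) * (l$1 + l$4) * (l$2 + l$4) * (l$3 + l$4)"
  have pos: "l$2 + l$3 > 0" "l$1 + l$3 > 0" "l$1 + l$2 > 0" "l$1 + l$4 > 0" "l$2 + l$4 > 0" "l$3 + l$4 > 0"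
    by (rule l; simp)+
  then have P: "P > 0" by (simp add: P_def)
  define e1 where "e1 = l$1 + l$2 + l$3 + l$4"
  define e2 where "e2 = l$1 * l$2 + l$1 * l$3 + l$1 * l$4 + l$2 * l$3 + l$2 * l$4 + l$3 * l$4"
  define e3 where "e3 = l$1 * l$2 * l$3 + l$1 * l$2 * l$4 + l$1 * l$3 * l$4 + l$2 * l$3 * l$4"
  define e4 where "e4 = l$1 * l$2 * l$3 * l$4"
  note defs = P_def e1_def e2_def e3_def e4_def
  have compl: "-{2, 3} = {1, 4::4}" "-{1, 4} = {2, 3::4}" "-{1, 3} = {2, 4::4}" "-{2, 4} = {1, 3::4}"
    "-{1, 2} = {3, 4::4}" "-{3, 4} = {1, 2::4}"
    unfolding Compl_eq_Diff_UNIV UNIV_4 by auto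
  have key: "(l$i + l$j) * (e1 * (\<Prod>k\<in>-{i, j}. (l$k)\<^sup>2) + e3 * (\<Sum>k\<in>-{i, j}. (l$k)\<^sup>2) + (e2 * e3 - e1 * e4)) = P"
    if "i \<noteq> j" for i j
  proof (rule pairs_4_cases[OF _ _ _ _ _ _ _ that], goal_cases)
    case (1 i j)
    then show ?case by (simp only: insert_commute[of j i] add.commute[of "l$j" "l$i"])
  qed (simp_all only: compl, simp_all, unfold defs, algebra+)
  show thesis
  proof
    have "2 * e1 = (l$1 + l$2) + (l$3 + l$4) + e1" by (simp add: e1_def)
    then have "e1 > 0" using pos unfolding e1_def by linarith
    then show "e1 / P > 0" using P by simp
    have "1 / (l$i + l$j) = e1 / P * (\<Prod>k\<in>-{i, j}. (l$k)\<^sup>2) + e3 / P * (\<Sum>k\<in>-{i, j}. (l$k)\<^sup>2) + (e2 * e3 - e1 * e4) / P"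
      if "i \<noteq> j" for i j
      using key[OF that] l[OF that] P
      by (simp add: add_divide_distrib[symmetric] frac_eq_eq mult.commute)
    then show "\<forall>i j. i \<noteq> j \<longrightarrow> 1 / (l$i + l$j) =
      e1 / P * (\<Prod>k\<in>-{i, j}. (l$k)\<^sup>2) + e3 / P * (\<Sum>k\<in>-{i, j}. (l$k)\<^sup>2) + (e2 * e3 - e1 * e4) / P"
      by blast
  qed
qed

lemma sum_via_complement:
  fixes L :: "real^4"
  assumes "i \<noteq> j"
  shows "L$i + L$j = (L$1 + L$2 + L$3 + L$4) - (\<Sum>k\<in>-{i, j}. L$k)"
proof -
  have "(\<Sum>k\<in>UNIV. L$k) = (\<Sum>k\<in>{i, j}. L$k) + (\<Sum>k\<in>-{i, j}. L$k)"
    by (subst sum.union_disjoint[symmetric]) auto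
  then show ?thesis using assms by (simp add: sum_4)
qed

text \<open>Since no sign of \<open>p\<close> is prescribed, this covers the two points \<open>\<plusminus> M1 a b\<close> of the theorem
at once.\<close>

lemma M1_equilibrium:
  fixes l :: "real^4" and c1 c2 p q :: real
  assumes l: "l$1 > l$2" "l$2 > l$3" "l$3 > l$4" and sums: "\<And>i j. i \<noteq> j \<Longrightarrow> l$i + l$j > 0"
    and pq: "q\<^sup>2 < p\<^sup>2" and c: "c1 = (p\<^sup>2 + q\<^sup>2) / 2" "c2 = p * q"
  shows "M1 p q \<in> orb c1 c2" "rigid_body l (M1 p q) = 0"
    "nondegenerate_equilibrium (energy l) (integral_I l) c1 c2 (M1 p q)"
    "center_center_type (energy l) (integral_I l) c1 c2 (M1 p q)"
    "lyapunov_stable (rigid_body l) so4 (M1 p q)"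
proof -
  let ?M = "M1 p q" and ?h = "\<lambda>i j. 1 / (l$i + l$j)" and ?g = "\<lambda>i j. 2 * ((l$i)\<^sup>2 + (l$j)\<^sup>2)"
  define L :: "real^4" where "L = (\<chi> i. (l$i)\<^sup>2)"
  have less: "y\<^sup>2 < x\<^sup>2" if "y < x" "x + y > 0" for x y :: real
  proof -
    have "0 < (x - y) * (x + y)" using that by simp
    then show ?thesis by (simp add: power2_eq_square algebra_simps)
  qed
  have L: "L$1 > L$2" "L$2 > L$3" "L$3 > L$4"
    using less[OF l(1) sums[of 1 2]] less[OF l(2) sums[of 2 3]] less[OF l(3) sums[of 3 4]]
    by (simp_all add: L_def)
  obtain t t' s r
    where modes: "normal_modes p q (t - t') s r"
      and "\<forall>i. (s$i)\<^sup>2 = t - L$i" "\<forall>i. (r$i)\<^sup>2 = L$i - t'"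
    by (rule normal_modes_exist[OF L pq])
  then have s: "(s$i)\<^sup>2 = t - L$i" and r: "(r$i)\<^sup>2 = L$i - t'" for i by blast+
  interpret normal_modes p q "t - t'" s r by (rule modes)
  interpret sw: normal_modes p q "t - t'" r s by (rule swap)
  have tt: "t \<noteq> t'" using d by simp
  obtain A B C where A: "A > 0"
    and "\<forall>i j. i \<noteq> j \<longrightarrow> ?h i j = A * (\<Prod>k\<in>-{i, j}. L$k) + B * (\<Sum>k\<in>-{i, j}. L$k) + C"
    unfolding L_def vec_lambda_beta by (rule inverse_sum_via_complement[OF sums])
  then have h: "?h i j = A * (\<Prod>k\<in>-{i, j}. L$k) + B * (\<Sum>k\<in>-{i, j}. L$k) + C" if "i \<noteq> j" for i j
    using that by blast
  define \<alpha> \<beta> where "\<alpha> = - (A * t' + B) / (t - t')" and "\<beta> = (A * t + B) / (t - t')"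
  have h: "?h i j = \<alpha> * mode_weight s i j + \<beta> * mode_weight r i j + (A * t * t' + B * (t + t') + C)"
    if "i \<noteq> j" for i j
    unfolding h[OF that] affine_in_mode_weights[OF s r tt that] \<alpha>_def \<beta>_def ..
  define \<alpha>' where "\<alpha>' = 2 / (t - t')"
  obtain C' where g: "\<And>i j. i \<noteq> j \<Longrightarrow> ?g i j = \<alpha>' * mode_weight s i j + (- \<alpha>') * mode_weight r i j + C'"
  proof
    fix i j :: 4 assume ij: "i \<noteq> j"
    let ?E = "L$1 + L$2 + L$3 + L$4"
    have "?g i j = 0 * (\<Prod>k\<in>-{i, j}. L$k) + (- 2) * (\<Sum>k\<in>-{i, j}. L$k) + 2 * ?E"
      using sum_via_complement[OF ij, of L] by (simp add: L_def)
    then show "?g i j = \<alpha>' * mode_weight s i j + (- \<alpha>') * mode_weight r i j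
        + (0 * t * t' + (- 2) * (t + t') + 2 * ?E)"
      unfolding affine_in_mode_weights[OF s r tt ij] by (simp add: \<alpha>'_def)
  qed
  show M: "?M \<in> orb c1 c2" using c by (simp add: M1_in_orb_iff)
  have f: "rigid_body l N = diagonal_field ?h N" if "N \<in> so4" for N
    using rigid_body_eq_diagonal_field[OF sums that] .
  show "lyapunov_stable (rigid_body l) so4 ?M"
    using h f by (rule M1_stable)
  show "rigid_body l ?M = 0" by (simp add: f diagonal_field_M1)
  let ?T = "orb_tangent ?M"
  interpret symplectic_chart ?T "orb_form ?M" chart
    by (rule symplectic_chart.intro[OF subspace_tangent linear_chart chart_bij chart_symplectic])
  let ?k = "\<bar>mode_frequency p q (t - t') s\<bar>" and ?m = "\<bar>mode_frequency p q (t - t') r\<bar>"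
  have pull: "linearized_field p q f' = pull (center_center_matrix (- a * ?k) (- b * ?m))"
    if "\<And>i j. i \<noteq> j \<Longrightarrow> f' i j = a * mode_weight s i j + b * mode_weight r i j + e" for f' a b e
    using chart_linearized_field[OF _ that] linearized_field_extensional
    by (intro pull_eqI) (auto simp: PiE_def)
  have H: "linearized_field p q ?h = pull (center_center_matrix (- \<alpha> * ?k) (- \<beta> * ?m))"
    by (rule pull) (rule h)
  have G: "linearized_field p q ?g = pull (center_center_matrix (- \<alpha>' * ?k) (- (- \<alpha>') * ?m))"
    by (rule pull) (rule g)
  have "linearization_algebra (energy l) (integral_I l) c1 c2 ?M =
      lie_generated ?T {linearized_field p q ?h, linearized_field p q ?g}"
    by (simp add: linearization_algebra_def linearized_field_def c energy_eq_diagonal_form integral_I_eq_diagonal_form)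
  also have "\<dots> = pull ` center_center_matrices"
    unfolding H G
  proof (rule center_center_generated)
    \<comment> \<open>The determinant of the two weights with respect to the mode weights is \<open>- \<alpha>' (\<alpha> + \<beta>)\<close>.\<close>
    have "\<alpha> + \<beta> = A * (t - t') / (t - t')"
      unfolding \<alpha>_def \<beta>_def add_divide_distrib[symmetric] by (simp add: algebra_simps)
    then have "\<alpha> + \<beta> = A" using tt by simp
    then have "- \<alpha> * ?k * (- (- \<alpha>') * ?m) - - \<alpha>' * ?k * (- \<beta> * ?m) = - (\<alpha>' * A * ?k * ?m)"
      by (auto simp: algebra_simps)
    then show "- \<alpha> * ?k * (- (- \<alpha>') * ?m) - - \<alpha>' * ?k * (- \<beta> * ?m) \<noteq> 0"
      using A tt frequency_nz sw.frequency_nz by (simp add: \<alpha>'_def)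
  qed
  finally have K: "linearization_algebra (energy l) (integral_I l) c1 c2 ?M = pull ` center_center_matrices" .
  show "nondegenerate_equilibrium (energy l) (integral_I l) c1 c2 ?M"
    unfolding nondegenerate_equilibrium_def K
    using M center_center_cartan orb_derivative_diagonal_form_M1[OF pq M]
    by (simp add: energy_eq_diagonal_form integral_I_eq_diagonal_form hamiltonian_field_diagonal_form diagonal_field_M1)
  show "center_center_type (energy l) (integral_I l) c1 c2 ?M"
    unfolding center_center_type_def K
    using linear_chart chart_bij chart_symplectic center_center_conjugate by blast
qed

theorem theorem5p2:
  fixes l :: "real^4" and c1 c2 a b :: real
  assumes "l$1 > l$2" and "l$2 > l$3" and "l$3 > l$4"
    and "\<And>i j. i \<noteq> j \<Longrightarrow> l$i + l$j > 0"
    and "c1 > \<bar>c2\<bar>"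
    and "a = 1 / sqrt 2 * (sqrt (c1 + c2) + sqrt (c1 - c2))"
    and "b = 1 / sqrt 2 * (sqrt (c1 + c2) - sqrt (c1 - c2))"
  shows "\<forall>M \<in> {M1 a b, M1 (-a) (-b)}.
      M \<in> cartan_t1 \<inter> orb c1 c2 \<and>
      rigid_body l M = 0 \<and>
      nondegenerate_equilibrium (energy l) (integral_I l) c1 c2 M \<and>
      center_center_type (energy l) (integral_I l) c1 c2 M \<and>
      lyapunov_stable (rigid_body l) (orb c1 c2) M \<and>
      lyapunov_stable (rigid_body l) so4 M"
proof -
  \<comment> \<open>The orbit is a product of two spheres, whose radii \<open>a + b\<close> and \<open>a - b\<close> are \<open>sqrt 2 * u\<close> and \<open>sqrt 2 * v\<close>.\<close>
  define u v where "u = sqrt (c1 + c2)" and "v = sqrt (c1 - c2)"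
  have uv: "u\<^sup>2 = c1 + c2" "v\<^sup>2 = c1 - c2" "u > 0" "v > 0"
    using assms(5) by (auto simp: u_def v_def)
  have ab: "a = (u + v) / sqrt 2" "b = (u - v) / sqrt 2"
    using assms(6,7) by (simp_all add: u_def v_def)
  have a2: "a\<^sup>2 = (u + v)\<^sup>2 / 2" and b2: "b\<^sup>2 = (u - v)\<^sup>2 / 2" and "a * b = (u\<^sup>2 - v\<^sup>2) / 2"
    unfolding ab by (simp_all add: power_divide) (simp add: power2_eq_square algebra_simps)
  then have c: "c1 = (a\<^sup>2 + b\<^sup>2) / 2" "c2 = a * b"
    using uv(1,2) by (simp_all add: power2_sum power2_diff)
  have "a\<^sup>2 - b\<^sup>2 = 2 * u * v" unfolding a2 b2 by (simp add: power2_sum power2_diff field_simps)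
  then have "b\<^sup>2 < a\<^sup>2" using uv(3,4) by (smt (verit) mult_pos_pos)
  have "M \<in> cartan_t1 \<inter> orb c1 c2 \<and> rigid_body l M = 0 \<and>
      nondegenerate_equilibrium (energy l) (integral_I l) c1 c2 M \<and>
      center_center_type (energy l) (integral_I l) c1 c2 M \<and>
      lyapunov_stable (rigid_body l) (orb c1 c2) M \<and> lyapunov_stable (rigid_body l) so4 M"
    if M: "M = M1 p q" and pq: "p = a \<and> q = b \<or> p = - a \<and> q = - b" for M p q
  proof -
    have *: "q\<^sup>2 < p\<^sup>2" "c1 = (p\<^sup>2 + q\<^sup>2) / 2" "c2 = p * q" using c \<open>b\<^sup>2 < a\<^sup>2\<close> pq by auto
    note E = M1_equilibrium[OF assms(1-4) *, folded M]
    show ?thesis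
      using E lyapunov_stable_subset[OF E(5) orb_subset_so4 E(1)] by (auto simp: cartan_t1_def M)
  qed
  then show ?thesis by blast
qed

end
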